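(* Let $G$ be a finitely generated free group acting by measure preserving bijections on a standard probability space $(X,\mu)$. Let $S_1$ and $S_2$ be two free generating sets for $G$. If $(X,\mu)$ is an $(S_1,\alpha_1)$-Markov process with $\mathrm{H}(\alpha_1)<\infty$, then there exists a countable measurable partition $\alpha_2$ with $\mathrm{H}(\alpha_2)<\infty$ such that $(X,\mu)$ is an $(S_2,\alpha_2)$-Markov process.
   Context: The Shannon entropy of a countable measurable partition is $\mathrm{H}(\alpha)=\sum_{A\in\alpha}-\mu(A)\log\mu(A)$. For a partition $\alpha$, $g\cdot\alpha=\{g\cdot A: A\in\alpha\}$; for $F\subseteq G$, $F\cdot\alpha=\bigvee_{f\in F}f\cdot\alpha$, which for infinite $F$ denotes the $\sigma$-algebra generated by the sets in all the $f\cdot\alpha$. A countable measurable partition $\alpha$ is generating if $G\cdot\alpha$ contains every measurable set up to null sets. Markov process: let $S$ be a free generating set of a free group $G$. For $s\in S\cup S^{-1}$ let $\mathrm{RPast}_S(1_G,s)$ be the set of $g\in G$ such that the unique non-self-intersecting path from $g$ to $s$ in the right $S$-Cayley graph of $G$ (vertex set $G$, edges $(g,gs')$, $s'\in S\cup S^{-1}$) passes through $1_G$; equivalently, the set of $g$ whose reduced $S$-word does not begin on the left with $s$. A measure preserving action of $G$ on $(X,\mu)$ is an $(S,\alpha)$-Markov process, where $\alpha$ is a countable measurable partition, if $\alpha$ is generating and for every $A\in\alpha$, $s\in S\cup S^{-1}$ and $\mu$-a.e. $x\in X$, $$\mathbb{E}\big(\chi_{s\cdot A}\mid \mathrm{RPast}_S(1_G,s)\cdot\alpha\big)(x)=\mathbb{E}(\chi_{s\cdot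 A}\mid\alpha)(x),$$ where $\mathbb{E}(\cdot\mid\cdot)$ is conditional expectation. *)

theory Defs
  imports "HOL-Algebra.Algebra" "HOL-Probability.Probability"
begin

section \<open>Free groups\<close>

text \<open>
  A word over \<open>S\<close> is a list of letters \<open>(s, e)\<close>, read as \<open>s\<close> if \<open>e\<close> holds and as the formal
  inverse of \<open>s\<close> otherwise. Letters are not taken in \<open>S \<union> S\<inverse>\<close>, since an involution in \<open>S\<close>
  would then coincide with its formal inverse.
\<close>

definition reduced_words :: "'g set \<Rightarrow> ('g \<times> bool) list set" where
  "reduced_words S =
     {w. fst ` set w \<subseteq> S \<and> successively (\<lambda>(s, d) (t, e). \<not> (s = t \<and> d \<noteq> e)) w}"

definition word_val :: "('g, 'm) monoid_scheme \<Rightarrow> ('g \<times> bool) list \<Rightarrow> 'g" where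
  "word_val G w =
     foldr (\<lambda>(s, e) x. (if e then s else inv\<^bsub>G\<^esub> s) \<otimes>\<^bsub>G\<^esub> x) w \<one>\<^bsub>G\<^esub>"

definition free_generating_set :: "('g, 'm) monoid_scheme \<Rightarrow> 'g set \<Rightarrow> bool" where
  "free_generating_set G S \<longleftrightarrow>
     S \<subseteq> carrier G \<and> bij_betw (word_val G) (reduced_words S) (carrier G)"

definition free_group :: "('g, 'm) monoid_scheme \<Rightarrow> bool" where
  "free_group G \<longleftrightarrow> group G \<and> (\<exists>S. free_generating_set G S)"

definition finitely_generated_group :: "('g, 'm) monoid_scheme \<Rightarrow> bool" where
  "finitely_generated_group G \<longleftrightarrow>
     group G \<and> (\<exists>T. finite T \<and> T \<subseteq> carrier G \<and> generate G T = carrier G)"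

definition sym_gens :: "('g, 'm) monoid_scheme \<Rightarrow> 'g set \<Rightarrow> 'g set" where
  "sym_gens G S = S \<union> m_inv G ` S"

definition cayley_edge :: "('g, 'm) monoid_scheme \<Rightarrow> 'g set \<Rightarrow> 'g \<Rightarrow> 'g \<Rightarrow> bool" where
  "cayley_edge G S g h \<longleftrightarrow> g \<in> carrier G \<and> (\<exists>t\<in>sym_gens G S. h = g \<otimes>\<^bsub>G\<^esub> t)"

text \<open>Paths are given by their vertices; the one-vertex path is allowed.\<close>

definition simple_cayley_path ::
    "('g, 'm) monoid_scheme \<Rightarrow> 'g set \<Rightarrow> 'g \<Rightarrow> 'g \<Rightarrow> 'g list \<Rightarrow> bool" where
  "simple_cayley_path G S g h p \<longleftrightarrow>
     p \<noteq> [] \<and> set p \<subseteq> carrier G \<and> hd p = g \<and> last p = h \<and>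
     successively (cayley_edge G S) p \<and> distinct p"

text \<open>
  The description is only meaningful when \<open>S\<close> is a free generating set: then the Cayley graph
  is a tree, and there is exactly one simple path between two vertices.
\<close>

definition RPast :: "('g, 'm) monoid_scheme \<Rightarrow> 'g set \<Rightarrow> 'g \<Rightarrow> 'g \<Rightarrow> 'g set" where
  "RPast G S u v = {g \<in> carrier G. u \<in> set (THE p. simple_cayley_path G S g v p)}"


section \<open>Probability measure preserving actions\<close>

definition standard_borel_space :: "'a measure \<Rightarrow> bool" where
  "standard_borel_space M \<longleftrightarrow>
     (\<exists>T. completely_metrizable_space T \<and> separable_space T \<and>
          topspace T = space M \<and> sets M = sigma_sets (space M) {U. openin T U})"

definition standard_prob_space :: "'a measure \<Rightarrow> bool" where
  "standard_prob_space M \<longleftrightarrow> prob_space M \<and> standard_borel_space M"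

definition pmp_action ::
    "('g, 'm) monoid_scheme \<Rightarrow> 'a measure \<Rightarrow> ('g \<Rightarrow> 'a \<Rightarrow> 'a) \<Rightarrow> bool" where
  "pmp_action G M \<phi> \<longleftrightarrow> group_action G (space M) \<phi> \<and>
     (\<forall>g\<in>carrier G. \<phi> g \<in> measurable M M \<and> distr M M (\<phi> g) = M)"


section \<open>Partitions and Markov processes\<close>

definition countable_measurable_partition :: "'a measure \<Rightarrow> 'a set set \<Rightarrow> bool" where
  "countable_measurable_partition M \<alpha> \<longleftrightarrow>
     partition_on (space M) \<alpha> \<and> countable \<alpha> \<and> \<alpha> \<subseteq> sets M"

text \<open>
  The terms are nonnegative, so nothing is truncated in \<^typ>\<open>ennreal\<close>, and a divergent sum has
  the value \<open>\<infinity>\<close>.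
\<close>

definition shannon_entropy :: "'a measure \<Rightarrow> 'a set set \<Rightarrow> ennreal" where
  "shannon_entropy M \<alpha> = (\<Sum>\<^sub>\<infinity>A\<in>\<alpha>. ennreal (- measure M A * ln (measure M A)))"

text \<open>
  The \<open>\<sigma>\<close>-algebra \<open>F \<cdot> \<alpha>\<close>, as a measurable space. For finite \<open>F\<close> it is the \<open>\<sigma>\<close>-algebra
  generated by the join of the partitions \<open>f \<cdot> \<alpha>\<close>.
\<close>

definition translates_algebra ::
    "'a measure \<Rightarrow> ('g \<Rightarrow> 'a \<Rightarrow> 'a) \<Rightarrow> 'g set \<Rightarrow> 'a set set \<Rightarrow> 'a measure" where
  "translates_algebra M \<phi> F \<alpha> = sigma (space M) {\<phi> f ` A |f A. f \<in> F \<and> A \<in> \<alpha>}"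

definition generating_partition ::
    "('g, 'm) monoid_scheme \<Rightarrow> 'a measure \<Rightarrow> ('g \<Rightarrow> 'a \<Rightarrow> 'a) \<Rightarrow> 'a set set \<Rightarrow> bool" where
  "generating_partition G M \<phi> \<alpha> \<longleftrightarrow>
     (\<forall>B\<in>sets M. \<exists>C\<in>sets (translates_algebra M \<phi> (carrier G) \<alpha>).
        sym_diff B C \<in> null_sets M)"

definition markov_process ::
    "('g, 'm) monoid_scheme \<Rightarrow> 'a measure \<Rightarrow> ('g \<Rightarrow> 'a \<Rightarrow> 'a) \<Rightarrow> 'g set \<Rightarrow> 'a set set \<Rightarrow> bool" where
  "markov_process G M \<phi> S \<alpha> \<longleftrightarrow>
     countable_measurable_partition M \<alpha> \<and>
     generating_partition G M \<phi> \<alpha> \<and>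
     (\<forall>A\<in>\<alpha>. \<forall>s\<in>sym_gens G S. AE x in M.
        real_cond_exp M (translates_algebra M \<phi> (RPast G S \<one>\<^bsub>G\<^esub> s) \<alpha>) (indicator (\<phi> s ` A)) x =
        real_cond_exp M (sigma (space M) \<alpha>) (indicator (\<phi> s ` A)) x)"

end

theory Submission
  imports Defs
begin

text \<open>
  Fix free generating sets \<open>S\<^sub>1\<close>, \<open>S\<^sub>2\<close>, and let \<open>F\<close> be a ball around the identity in the word metric of
  \<open>S\<^sub>2\<close>, of radius at least the \<open>S\<^sub>2\<close>-length of every element of \<open>S\<^sub>1\<close>. The partition \<open>\<alpha>\<^sub>2 = F \<cdot> \<alpha>\<^sub>1\<close>
  works: the translates \<open>g F\<close> are the bags of a tree decomposition of the \<open>S\<^sub>1\<close>-Cayley tree indexed by the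
  \<open>S\<^sub>2\<close>-Cayley tree, so that \<open>F\<close> separates \<open>s F\<close> from all \<open>g F\<close> with \<open>g\<close> in the past of \<open>s\<close>. The joint law
  of the labels on a finite subtree of the \<open>S\<^sub>1\<close>-tree factorizes over its edges, hence labels on the
  two sides of a separating set are conditionally independent given the labels on that set.
  Finite entropy is inherited because \<open>F\<close> is finite.
\<close>

section \<open>Reduced words\<close>

text \<open>The Markov hypothesis speaks of one edge and everything on one side of it, whereas a
  ball of the second basis need not be connected in the first tree, so the hypothesis cannot be
  applied directly to the labels on \<open>F\<close>. The detour is a large finite window closed
  under prefixes for the first basis. Its law is assembled from edge weights; every edge lies on one
  side of the separation, and the labels off the separating set are summed out. The shape of
  \<open>F\<close> is irrelevant; what counts is that no edge of the first tree jumps between two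
  branches of the second tree outside \<open>F\<close>, and this is what the radius ensures. The
  infinite past is then reached from finite windows by a Dynkin argument. Since the partitions are
  countable, conditional expectations are traded for identities P(D B b) P(b) = P(D b) P(B b), which
  are multiplied out so that null cells need no separate treatment.\<close>

definition linv :: "'g \<times> bool \<Rightarrow> 'g \<times> bool" where
  "linv l = (fst l, \<not> snd l)"

lemma linv_linv [simp]: "linv (linv l) = l"
  by (simp add: linv_def)

lemma linv_eq_iff: "linv l = m \<longleftrightarrow> l = linv m"
  by (auto simp: linv_def)

lemma reduced_words_iff:
  "w \<in> reduced_words S \<longleftrightarrow> set w \<subseteq> S \<times> UNIV \<and> successively (\<lambda>l m. m \<noteq> linv l) w"
proof -
  have "(\<lambda>(s, d) (t, e). \<not> (s = t \<and> d \<noteq> e)) = (\<lambda>l m. m \<noteq> linv (l :: 'a \<times> bool))"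
    by (auto simp: linv_def fun_eq_iff)
  then show ?thesis
    unfolding reduced_words_def by auto
qed

lemma Nil_reduced [simp]: "[] \<in> reduced_words S"
  by (simp add: reduced_words_iff)

lemma Cons_reduced:
  "l # w \<in> reduced_words S \<longleftrightarrow>
     l \<in> S \<times> UNIV \<and> w \<in> reduced_words S \<and> (w = [] \<or> hd w \<noteq> linv l)"
  by (auto simp: reduced_words_iff successively_Cons)

lemma append_reduced:
  "v @ w \<in> reduced_words S \<longleftrightarrow>
     v \<in> reduced_words S \<and> w \<in> reduced_words S \<and> (v = [] \<or> w = [] \<or> hd w \<noteq> linv (last v))"
  by (auto simp: reduced_words_iff successively_append_iff)

lemma take_reduced: "w \<in> reduced_words S \<Longrightarrow> take n w \<in> reduced_words S"
  by (metis append_take_drop_id append_reduced)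

lemma rev_map_linv_reduced:
  "w \<in> reduced_words S \<Longrightarrow> rev (map linv w) \<in> reduced_words S"
proof -
  have "(\<lambda>x y. linv x \<noteq> y) = (\<lambda>l m. m \<noteq> linv (l :: 'a \<times> bool))"
    by (auto simp: fun_eq_iff)
  moreover have "linv ` (S \<times> UNIV) \<subseteq> S \<times> UNIV"
    by (auto simp: linv_def)
  ultimately show "w \<in> reduced_words S \<Longrightarrow> rev (map linv w) \<in> reduced_words S"
    by (auto simp: reduced_words_iff successively_map elim!: successively_mono)
qed

section \<open>Values of words in a group\<close>

context group
begin

definition lval :: "'a \<times> bool \<Rightarrow> 'a" where
  "lval l = (if snd l then fst l else inv fst l)"

lemma word_val_Nil [simp]: "word_val G [] = \<one>"
  by (simp add: word_val_def)

lemma word_val_Cons [simp]: "word_val G (l # w) = lval l \<otimes> word_val G w"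
  by (simp add: word_val_def lval_def split: prod.split)

lemma lval_closed [simp]: "S \<subseteq> carrier G \<Longrightarrow> l \<in> S \<times> UNIV \<Longrightarrow> lval l \<in> carrier G"
  by (auto simp: lval_def)

lemma lval_linv: "S \<subseteq> carrier G \<Longrightarrow> l \<in> S \<times> UNIV \<Longrightarrow> lval (linv l) = inv (lval l)"
  by (auto simp: lval_def linv_def)

lemma word_val_closed [simp]:
  "S \<subseteq> carrier G \<Longrightarrow> set w \<subseteq> S \<times> UNIV \<Longrightarrow> word_val G w \<in> carrier G"
  by (induction w) auto

lemma word_val_append:
  assumes "S \<subseteq> carrier G" "set v \<subseteq> S \<times> UNIV" "set w \<subseteq> S \<times> UNIV"
  shows "word_val G (v @ w) = word_val G v \<otimes> word_val G w"
  using assms(2)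
proof (induction v)
  case (Cons l v)
  then have "lval l \<in> carrier G" "word_val G v \<in> carrier G" "word_val G w \<in> carrier G"
    using assms by (auto intro!: lval_closed[of S] word_val_closed[of S])
  then show ?case
    using Cons by (simp add: m_assoc)
qed (use assms in simp)

lemma word_val_rev_map_linv:
  assumes "S \<subseteq> carrier G" "set w \<subseteq> S \<times> UNIV"
  shows "word_val G (rev (map linv w)) = inv (word_val G w)"
  using assms(2)
proof (induction w)
  case (Cons l w)
  have c: "lval l \<in> carrier G" "word_val G w \<in> carrier G"
    using assms Cons by (auto intro!: lval_closed[of S] word_val_closed[of S])
  have "set (rev (map linv w)) \<subseteq> S \<times> UNIV" "set [linv l] \<subseteq> S \<times> UNIV"
    using Cons.prems by (auto simp: linv_def)
  then have "word_val G (rev (map linv (l # w))) = inv (word_val G w) \<otimes> inv (lval l)"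
    using Cons assms(1) word_val_append[of S "rev (map linv w)" "[linv l]"] c
    by (auto simp: lval_linv[of S])
  then show ?case
    using c by (simp add: inv_mult_group)
qed simp

text \<open>Free reduction from the right: a new letter either extends the reduced word or cancels
  its head. \<open>S\<close> is any subset of the carrier because \<open>finite_basis\<close>
  applies this to a set not yet known to be a basis.\<close>

lemma exists_reduced_word:
  assumes "S \<subseteq> carrier G" "set w \<subseteq> S \<times> UNIV"
  shows "\<exists>v\<in>reduced_words S. word_val G v = word_val G w"
  using assms(2)
proof (induction w)
  case (Cons l w)
  then obtain v where v: "v \<in> reduced_words S" "word_val G v = word_val G w"
    by auto
  have l: "l \<in> S \<times> UNIV" using Cons by auto
  show ?case
  proof (cases "v = [] \<or> hd v \<noteq> linv l")
    case True
    then have "l # v \<in> reduced_words S" using v l by (simp add: Cons_reduced)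
    then show ?thesis using v by (intro bexI[of _ "l # v"]) auto
  next
    case False
    then obtain u where u: "v = linv l # u" by (cases v) auto
    have ur: "u \<in> reduced_words S" using v u by (simp add: Cons_reduced)
    then have "word_val G u \<in> carrier G" "lval l \<in> carrier G"
      using assms(1) l by (auto simp: reduced_words_iff intro!: lval_closed[of S] word_val_closed[of S])
    then have "word_val G (l # w) = word_val G u"
      using u v assms(1) l
      by (simp flip: v(2) add: lval_linv[of S] m_assoc[symmetric])
    then show ?thesis using ur by metis
  qed
qed (auto intro!: bexI[of _ "[]"])

end

section \<open>Reduced words as normal forms in a free group\<close>

locale free_basis = group G for G :: "('g, 'm) monoid_scheme" (structure) +
  fixes S :: "'g set"
  assumes free: "free_generating_set G S"
begin

lemma S_closed: "S \<subseteq> carrier G"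
  using free by (simp add: free_generating_set_def)

lemmas lval_carrier [simp] = lval_closed[OF S_closed]
lemmas word_val_carrier [simp] = word_val_closed[OF S_closed]
lemmas word_val_app = word_val_append[OF S_closed]

definition word :: "'g \<Rightarrow> ('g \<times> bool) list" where
  "word g = the_inv_into (reduced_words S) (word_val G) g"

lemma reduced_letters [dest]: "w \<in> reduced_words S \<Longrightarrow> set w \<subseteq> S \<times> UNIV"
  by (simp add: reduced_words_iff)

lemma word_reduced: "g \<in> carrier G \<Longrightarrow> word g \<in> reduced_words S"
  and word_val_word [simp]: "g \<in> carrier G \<Longrightarrow> word_val G (word g) = g"
  using free unfolding free_generating_set_def word_def
  by (auto simp: bij_betw_def the_inv_into_into f_the_inv_into_f)

lemma word_word_val [simp]: "w \<in> reduced_words S \<Longrightarrow> word (word_val G w) = w"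
  using free unfolding free_generating_set_def word_def
  by (auto simp: bij_betw_def the_inv_into_f_f)

lemma word_eqI: "w \<in> reduced_words S \<Longrightarrow> word_val G w = g \<Longrightarrow> word g = w"
  by auto

lemma word_one [simp]: "word \<one> = []"
  by (rule word_eqI) auto

lemma word_letters: "g \<in> carrier G \<Longrightarrow> set (word g) \<subseteq> S \<times> UNIV"
  using word_reduced by auto

lemma word_lval: "l \<in> S \<times> UNIV \<Longrightarrow> word (lval l) = [l]"
  by (rule word_eqI) (auto simp: Cons_reduced lval_closed[OF S_closed])

lemma word_inv: "g \<in> carrier G \<Longrightarrow> word (inv g) = rev (map linv (word g))"
  using word_reduced[of g] word_letters[of g]
  by (intro word_eqI rev_map_linv_reduced) (auto simp: word_val_rev_map_linv[OF S_closed])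

text \<open>In the Cayley tree rooted at \<open>\<one>\<close>, one step along an edge goes to the
  parent (\<open>butlast\<close>) or to a child.\<close>

lemma word_mult_lval:
  assumes "g \<in> carrier G" "l \<in> S \<times> UNIV"
  shows "word (g \<otimes> lval l) =
    (if word g \<noteq> [] \<and> last (word g) = linv l then butlast (word g) else word g @ [l])"
proof (cases "word g \<noteq> [] \<and> last (word g) = linv l")
  case True
  define v where "v = butlast (word g)"
  have w: "word g = v @ [linv l]"
    using True unfolding v_def by (metis append_butlast_last_id)
  have r: "v \<in> reduced_words S"
    using word_reduced[OF assms(1)] unfolding w append_reduced by simp
  have "g = word_val G v \<otimes> lval (linv l)"
    using word_val_word[OF assms(1)] word_val_app[of v "[linv l]"] r assms(2)
    by (auto simp: w linv_def dest!: reduced_letters)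
  then have "g \<otimes> lval l = word_val G v"
    using r assms(2) S_closed by (simp add: lval_linv[of S] m_assoc reduced_letters)
  then show ?thesis using True r by (auto simp flip: v_def)
next
  case False
  have "word g @ [l] \<in> reduced_words S"
    using word_reduced[OF assms(1)] assms(2) False
    by (auto simp: append_reduced Cons_reduced linv_eq_iff)
  moreover have "word_val G (word g @ [l]) = g \<otimes> lval l"
    using assms word_letters[of g] word_val_app[of "word g" "[l]"] by auto
  ultimately show ?thesis using False word_eqI by auto
qed

text \<open>Each letter multiplied on the right acts at the end of the reduced word and shortens it
  by at most one, so fewer letters than its length cannot erase the first letter. This keeps points
  far from \<open>\<one>\<close> in their branch.\<close>

lemma hd_word_mult_word_val:
  assumes "g \<in> carrier G" "set w \<subseteq> S \<times> UNIV" "length w < length (word g)"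
  shows "word (g \<otimes> word_val G w) \<noteq> [] \<and> hd (word (g \<otimes> word_val G w)) = hd (word g)"
  using assms
proof (induction w arbitrary: g)
  case (Cons l w)
  have l: "l \<in> S \<times> UNIV" and w: "set w \<subseteq> S \<times> UNIV" using Cons.prems by auto
  \<comment> \<open>Two letters are required because the step by \<open>l\<close> may delete one of
    them.\<close>
  have "length (word g) \<ge> 2" using Cons.prems by auto
  then obtain a b v where v: "word g = a # b # v"
    by (metis Suc_le_length_iff numeral_2_eq_2)
  have "hd (word (g \<otimes> lval l)) = hd (word g)" "length (word (g \<otimes> lval l)) \<ge> length (word g) - 1"
    using l Cons.prems(1) by (auto simp: word_mult_lval v)
  moreover have "g \<otimes> word_val G (l # w) = g \<otimes> lval l \<otimes> word_val G w"
    using l w Cons.prems(1) by (simp add: m_assoc)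
  ultimately show ?case
    using Cons.IH[of "g \<otimes> lval l"] Cons.prems l w by auto
qed auto

lemma hd_word_mult:
  assumes "g \<in> carrier G" "k \<in> carrier G" "length (word k) < length (word g)"
  shows "word (g \<otimes> k) \<noteq> []" "hd (word (g \<otimes> k)) = hd (word g)"
  using hd_word_mult_word_val[of g "word k"] assms word_letters by auto

lemma sym_gens_eq: "sym_gens G S = lval ` (S \<times> UNIV)"
proof
  show "sym_gens G S \<subseteq> lval ` (S \<times> UNIV)"
  proof
    fix s assume "s \<in> sym_gens G S"
    then consider "s \<in> S" | t where "t \<in> S" "s = inv t" by (auto simp: sym_gens_def)
    then show "s \<in> lval ` (S \<times> UNIV)"
    proof cases
      case 1
      then show ?thesis by (intro image_eqI[of _ _ "(s, True)"]) (auto simp: lval_def)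
    next
      case 2
      then show ?thesis by (intro image_eqI[of _ _ "(t, False)"]) (auto simp: lval_def)
    qed
  qed
qed (auto simp: sym_gens_def lval_def)

lemma sym_gens_closed: "sym_gens G S \<subseteq> carrier G"
  using S_closed by (auto simp: sym_gens_def)

subsection \<open>Paths in the Cayley graph\<close>

fun verts :: "'g \<Rightarrow> ('g \<times> bool) list \<Rightarrow> 'g list" where
  "verts g [] = [g]"
| "verts g (l # w) = g # verts (g \<otimes> lval l) w"

lemma verts_nonempty [simp]: "verts g w \<noteq> []"
  by (cases w) auto

lemma hd_verts [simp]: "hd (verts g w) = g"
  by (cases w) auto

lemma last_verts:
  "g \<in> carrier G \<Longrightarrow> set w \<subseteq> S \<times> UNIV \<Longrightarrow> last (verts g w) = g \<otimes> word_val G w"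
  by (induction w arbitrary: g) (auto simp: m_assoc)

text \<open>Indices beyond \<open>length w\<close> only repeat the endpoint, so prefixes may be
  indexed by all naturals.\<close>

lemma set_verts:
  assumes "g \<in> carrier G" "set w \<subseteq> S \<times> UNIV"
  shows "set (verts g w) = (\<lambda>n. g \<otimes> word_val G (take n w)) ` UNIV"
  using assms
proof (induction w arbitrary: g)
  case (Cons l w)
  have c: "word_val G (take n w) \<in> carrier G" for n
    using Cons.prems by (intro word_val_carrier) (auto dest: in_set_takeD)
  have "(\<lambda>n. g \<otimes> word_val G (take n (l # w))) ` UNIV =
      insert g ((\<lambda>n. g \<otimes> word_val G (take (Suc n) (l # w))) ` UNIV)"
    using Cons.prems by (subst UNIV_nat_eq) (simp add: image_image)
  also have "(\<lambda>n. g \<otimes> word_val G (take (Suc n) (l # w))) ` UNIV =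
      (\<lambda>n. g \<otimes> lval l \<otimes> word_val G (take n w)) ` UNIV"
    using Cons.prems c by (intro image_cong) (auto simp: m_assoc)
  finally show ?case
    using Cons by auto
qed auto

lemma cayley_path_verts:
  assumes "successively (cayley_edge G S) p" "p \<noteq> []" "set p \<subseteq> carrier G"
  shows "\<exists>w. set w \<subseteq> S \<times> UNIV \<and> p = verts (hd p) w"
  using assms
proof (induction p)
  case (Cons g p)
  show ?case
  proof (cases "p = []")
    case True
    then show ?thesis by (intro exI[of _ "[]"]) auto
  next
    case False
    then obtain w where w: "set w \<subseteq> S \<times> UNIV" "p = verts (hd p) w"
      using Cons by (auto simp: successively_Cons)
    have "cayley_edge G S g (hd p)"
      using Cons.prems False by (simp add: successively_Cons)
    then obtain l where l: "l \<in> S \<times> UNIV" "hd p = g \<otimes> lval l"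
      unfolding cayley_edge_def sym_gens_eq by blast
    then show ?thesis
      using w by (intro exI[of _ "l # w"]) auto
  qed
qed simp

lemma verts_cayley_path:
  "g \<in> carrier G \<Longrightarrow> set w \<subseteq> S \<times> UNIV \<Longrightarrow>
     successively (cayley_edge G S) (verts g w) \<and> set (verts g w) \<subseteq> carrier G"
proof (induction w arbitrary: g)
  case (Cons l w)
  then have "cayley_edge G S g (g \<otimes> lval l)"
    unfolding cayley_edge_def sym_gens_eq by auto
  then show ?case
    using Cons by (auto simp: successively_Cons)
qed auto

lemma distinct_verts_imp_reduced:
  "g \<in> carrier G \<Longrightarrow> set w \<subseteq> S \<times> UNIV \<Longrightarrow> distinct (verts g w) \<Longrightarrow> w \<in> reduced_words S"
proof (induction w arbitrary: g)
  case (Cons l w)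
  then have w: "w \<in> reduced_words S" using Cons.IH[of "g \<otimes> lval l"] by auto
  have "hd w \<noteq> linv l" if "w \<noteq> []"
  proof
    assume h: "hd w = linv l"
    with that obtain v where v: "w = linv l # v" by (cases w) auto
    have "g \<otimes> lval l \<otimes> lval (linv l) = g"
      using Cons.prems by (simp add: lval_linv[OF S_closed] m_assoc)
    then have "g \<in> set (verts (g \<otimes> lval l) w)"
      unfolding v by (metis hd_in_set hd_verts list.set_intros(2) verts.simps(2) verts_nonempty)
    then show False using Cons.prems by simp
  qed
  then show ?case using w Cons.prems by (auto simp: Cons_reduced)
qed auto

text \<open>Here freeness makes the Cayley graph a tree: a repeated vertex would give a nonempty
  reduced word with value \<open>\<one>\<close>.\<close>

lemma reduced_imp_distinct_verts:
  "g \<in> carrier G \<Longrightarrow> w \<in> reduced_words S \<Longrightarrow> distinct (verts g w)"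
proof (induction w arbitrary: g)
  case (Cons l w)
  have l: "l \<in> S \<times> UNIV" and w: "w \<in> reduced_words S"
    using Cons.prems by (auto simp: Cons_reduced)
  have "g \<notin> set (verts (g \<otimes> lval l) w)"
  proof
    assume "g \<in> set (verts (g \<otimes> lval l) w)"
    then obtain n where n: "g = g \<otimes> lval l \<otimes> word_val G (take n w)"
      using set_verts[of "g \<otimes> lval l" w] w l Cons.prems by auto
    have r: "take (Suc n) (l # w) \<in> reduced_words S"
      using Cons.prems by (intro take_reduced)
    then have "word_val G (take n w) \<in> carrier G"
      using w by (intro word_val_carrier) (auto dest!: reduced_letters in_set_takeD)
    then have "word_val G (take (Suc n) (l # w)) = \<one>"
      using n l Cons.prems by (simp add: m_assoc)
    then show False using word_word_val[OF r] by simp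
  qed
  then show ?case using Cons l w by simp
qed simp

text \<open>A simple path reads off a reduced word, since backtracking repeats a vertex; its
  endpoints fix the value of that word, and freeness fixes the word. So the \<open>THE\<close> in
  \<open>RPast\<close> denotes.\<close>

lemma the_simple_cayley_path:
  assumes "g \<in> carrier G" "h \<in> carrier G"
  shows "(THE p. simple_cayley_path G S g h p) = verts g (word (inv g \<otimes> h))"
proof (rule the_equality)
  let ?w = "word (inv g \<otimes> h)"
  have r: "?w \<in> reduced_words S" using assms by (simp add: word_reduced)
  have "g \<otimes> word_val G ?w = h"
    using assms by (simp add: m_assoc[symmetric])
  then show "simple_cayley_path G S g h (verts g ?w)"
    using assms r verts_cayley_path[of g ?w] reduced_imp_distinct_verts[of g ?w]
    unfolding simple_cayley_path_def by (auto simp: last_verts reduced_letters)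
next
  fix p assume p: "simple_cayley_path G S g h p"
  then obtain w where w: "set w \<subseteq> S \<times> UNIV" "p = verts g w"
    using cayley_path_verts unfolding simple_cayley_path_def by metis
  then have r: "w \<in> reduced_words S"
    using p assms distinct_verts_imp_reduced unfolding simple_cayley_path_def by auto
  have "g \<otimes> word_val G w = h"
    using p w assms last_verts unfolding simple_cayley_path_def by auto
  then have "inv g \<otimes> h = word_val G w"
    using assms w by (auto simp: m_assoc[symmetric])
  then show "p = verts g (word (inv g \<otimes> h))" using w r by simp
qed

text \<open>The path from \<open>g\<close> to \<open>lval l\<close> meets \<open>\<one>\<close>
  exactly when the word of \<open>inv g\<close> is a prefix of the word of
  \<open>inv g \<otimes> lval l\<close>. This fails only if \<open>l\<close> cancels the last letter
  of \<open>inv g\<close>, that is, if \<open>g\<close> begins with \<open>l\<close>.\<close>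

lemma RPast_eq:
  assumes l: "l \<in> S \<times> UNIV"
  shows "RPast G S \<one> (lval l) = {g \<in> carrier G. word g = [] \<or> hd (word g) \<noteq> l}"
proof -
  have "\<one> \<in> set (verts g (word (inv g \<otimes> lval l))) \<longleftrightarrow> word g = [] \<or> hd (word g) \<noteq> l"
    if g: "g \<in> carrier G" for g
  proof -
    let ?w = "word (inv g \<otimes> lval l)" and ?v = "word (inv g)"
    have r: "?w \<in> reduced_words S" using g l by (intro word_reduced) auto
    have t: "word_val G (take n ?w) \<in> carrier G" for n
      using take_reduced[OF r] by (intro word_val_carrier) auto
    have "\<one> \<in> set (verts g ?w) \<longleftrightarrow> (\<exists>n. \<one> = g \<otimes> word_val G (take n ?w))"
      using set_verts[of g ?w] g r by auto
    also have "\<dots> \<longleftrightarrow> (\<exists>n. word_val G (take n ?w) = inv g)"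
      using g t by (metis inv_equality inv_inv r_inv inv_closed)
    also have "\<dots> \<longleftrightarrow> (\<exists>n. take n ?w = ?v)"
      using g word_word_val[OF take_reduced[OF r]] by (metis inv_closed word_val_word)
    also have "\<dots> \<longleftrightarrow> \<not> (?v \<noteq> [] \<and> last ?v = linv l)"
    proof (cases "?v \<noteq> [] \<and> last ?v = linv l")
      case True
      then have "?w = butlast ?v" using g l by (simp add: word_mult_lval)
      then have "length (take n ?w) < length ?v" for n using True
        by (cases ?v) auto
      then show ?thesis using True by (metis nat_neq_iff)
    next
      case False
      then have "?w = ?v @ [l]" using g l word_mult_lval[of "inv g" l] by auto
      then have "take (length ?v) ?w = ?v" by simp
      then show ?thesis using False by blast
    qed
    also have "\<dots> \<longleftrightarrow> word g = [] \<or> hd (word g) \<noteq> l"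
      using g by (auto simp: word_inv last_rev hd_map linv_eq_iff)
    finally show ?thesis .
  qed
  then show ?thesis
    using l unfolding RPast_def by (auto simp: the_simple_cayley_path)
qed

text \<open>If \<open>inv u \<otimes> n\<close> began with \<open>l\<close>, multiplying by
  \<open>u\<close> would cause no cancellation, and \<open>n\<close> would lie beyond the edge
  \<open>l\<close> at \<open>u\<close>. With \<open>RPast_eq\<close>, this puts the points of a
  window in the past of a new leaf attached to \<open>u\<close>.\<close>

lemma hd_word_inv_mult:
  assumes u: "u \<in> carrier G" and n: "n \<in> carrier G" and r: "word u @ [l] \<in> reduced_words S"
    and np: "\<nexists>v. word n = word u @ [l] @ v"
  shows "word (inv u \<otimes> n) = [] \<or> hd (word (inv u \<otimes> n)) \<noteq> l"
proof (rule ccontr)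
  assume "\<not> ?thesis"
  then obtain v where v: "word (inv u \<otimes> n) = l # v"
    by (metis list.collapse)
  have lv: "l # v \<in> reduced_words S" using word_reduced[of "inv u \<otimes> n"] u n v by auto
  then have red: "word u @ l # v \<in> reduced_words S"
    using r u by (auto simp: append_reduced word_reduced)
  have "word_val G (l # v) = inv u \<otimes> n"
    using u n word_val_word[of "inv u \<otimes> n"] v by simp
  then have "word_val G (word u @ l # v) = u \<otimes> (inv u \<otimes> n)"
    using word_val_app[of "word u" "l # v"] u word_letters[OF u] reduced_letters[OF lv] by simp
  then have "word n = word u @ l # v"
    using u n red by (intro word_eqI) (auto simp: m_assoc[symmetric])
  then show False using np by auto
qed

subsection \<open>Finite generation\<close>

text \<open>Finitely many basis elements occur in the words of a finite generating set, and they
  generate the group. Any further basis element would have, besides its one-letter word, a second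
  reduced word in these letters.\<close>

lemma finite_basis:
  assumes "finitely_generated_group G"
  shows "finite S"
proof -
  obtain T where T: "finite T" "T \<subseteq> carrier G" "generate G T = carrier G"
    using assms unfolding finitely_generated_group_def by auto
  define S' where "S' = (\<Union>t\<in>T. fst ` set (word t))"
  have fin: "finite S'" using T by (auto simp: S'_def)
  have S': "S' \<subseteq> S"
  proof
    fix s assume "s \<in> S'"
    then obtain t l where "t \<in> T" "l \<in> set (word t)" "s = fst l" by (auto simp: S'_def)
    moreover have "set (word t) \<subseteq> S \<times> UNIV"
      using \<open>t \<in> T\<close> T(2) by (intro word_letters) auto
    ultimately show "s \<in> S" by auto
  qed
  then have S'c: "S' \<subseteq> carrier G" using S_closed by auto
  define H where "H = word_val G ` reduced_words S'"
  have Hv: "word_val G w \<in> H" if "set w \<subseteq> S' \<times> UNIV" for w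
    using exists_reduced_word[OF S'c that] unfolding H_def by (metis imageI)
  have letters: "set (word h) \<subseteq> S' \<times> UNIV" if "h \<in> T" for h
  proof
    fix l assume "l \<in> set (word h)"
    then have "fst l \<in> S'" using that by (auto simp: S'_def)
    then show "l \<in> S' \<times> UNIV" by (cases l) auto
  qed
  have "x \<in> H" if "x \<in> generate G T" for x
    using that
  proof (induction rule: generate.induct)
    case one
    show ?case using Hv[of "[]"] by simp
  next
    case (incl h)
    have "set (word h) \<subseteq> S' \<times> UNIV" using letters incl by auto
    then show ?case using Hv[of "word h"] incl T by auto
  next
    case (inv h)
    have "set (word h) \<subseteq> S' \<times> UNIV" using letters inv by auto
    then have "set (rev (map linv (word h))) \<subseteq> S' \<times> UNIV"
      by (auto simp: linv_def)
    then show ?case using Hv[of "rev (map linv (word h))"] inv T word_inv word_val_word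
      by (metis inv_closed subsetD)
  next
    case (eng h1 h2)
    then obtain v1 v2 where v: "v1 \<in> reduced_words S'" "h1 = word_val G v1"
        "v2 \<in> reduced_words S'" "h2 = word_val G v2"
      unfolding H_def by auto
    then have "set v1 \<subseteq> S' \<times> UNIV" "set v2 \<subseteq> S' \<times> UNIV"
      by (simp_all add: reduced_words_iff)
    then show ?case
      using Hv[of "v1 @ v2"] v word_val_append[OF S'c, of v1 v2] by auto
  qed
  then have "carrier G \<subseteq> H" using T by auto
  have "S \<subseteq> S'"
  proof
    fix s assume s: "s \<in> S"
    then have "s \<in> H" using S_closed \<open>carrier G \<subseteq> H\<close> by auto
    then obtain w where w: "w \<in> reduced_words S'" "word_val G w = s"
      unfolding H_def by auto
    then have "w \<in> reduced_words S" using S' by (auto simp: reduced_words_iff)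
    moreover have "word s = [(s, True)]"
      using word_lval[of "(s, True)"] s by (simp add: lval_def)
    ultimately have "w = [(s, True)]" using w(2) word_word_val by metis
    then show "s \<in> S'" using w(1) by (auto simp: reduced_words_iff)
  qed
  then show ?thesis using fin finite_subset by auto
qed

lemma finite_word_ball:
  assumes "finite S"
  shows "finite {g \<in> carrier G. length (word g) \<le> n}"
proof -
  have "finite {w. set w \<subseteq> S \<times> (UNIV :: bool set) \<and> length w \<le> n}"
    using assms by (intro finite_lists_length_le) auto
  moreover have "{g \<in> carrier G. length (word g) \<le> n} \<subseteq>
      word_val G ` {w. set w \<subseteq> S \<times> UNIV \<and> length w \<le> n}"
  proof
    fix g assume g: "g \<in> {g \<in> carrier G. length (word g) \<le> n}"
    then show "g \<in> word_val G ` {w. set w \<subseteq> S \<times> UNIV \<and> length w \<le> n}"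
      using word_letters[of g] by (intro image_eqI[of _ _ "word g"]) auto
  qed
  ultimately show ?thesis by (meson finite_imageI finite_subset)
qed

end

section \<open>Conditional expectation on a countable partition\<close>

lemma sigma_sets_partition_atom:
  assumes "partition_on \<Omega> \<beta>" "E \<in> sigma_sets \<Omega> \<beta>" "b \<in> \<beta>"
  shows "b \<subseteq> E \<or> b \<inter> E = {}"
  using assms(2)
proof (induction rule: sigma_sets.induct)
  case (Basic a)
  then show ?case using assms(1,3) by (auto simp: partition_on_def disjoint_def)
next
  case (Compl a)
  then show ?case using assms(1,3) by (auto simp: partition_on_def)
next
  case (Union a)
  then show ?case by blast
qed auto

context prob_space
begin

lemma partition_subset_Pow:
  "countable_measurable_partition M \<beta> \<Longrightarrow> \<beta> \<subseteq> Pow (space M)"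
  by (auto simp: countable_measurable_partition_def partition_on_def)

lemma partition_events:
  "countable_measurable_partition M \<beta> \<Longrightarrow> b \<in> \<beta> \<Longrightarrow> b \<in> events"
  by (auto simp: countable_measurable_partition_def)

lemma measurable_sigma_partition_const:
  fixes h :: "'a \<Rightarrow> real"
  assumes "countable_measurable_partition M \<beta>"
    and "h \<in> borel_measurable (sigma (space M) \<beta>)" "b \<in> \<beta>" "x \<in> b" "y \<in> b"
  shows "h x = h y"
proof -
  have P: "\<beta> \<subseteq> Pow (space M)" using partition_subset_Pow[OF assms(1)] .
  have part: "partition_on (space M) \<beta>"
    using assms(1) by (simp add: countable_measurable_partition_def)
  have "h -` {h x} \<inter> space (sigma (space M) \<beta>) \<in> sets (sigma (space M) \<beta>)"
    using assms(2) by (rule measurable_sets) simp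
  then have "h -` {h x} \<inter> space M \<in> sigma_sets (space M) \<beta>"
    using P by (simp add: space_measure_of)
  from sigma_sets_partition_atom[OF part this assms(3)]
  show ?thesis using assms P by auto
qed

lemma subalgebra_sigma_partition:
  assumes "countable_measurable_partition M \<beta>" "subalgebra M F" "\<beta> \<subseteq> sets F"
  shows "subalgebra F (sigma (space M) \<beta>)"
  using assms partition_subset_Pow[OF assms(1)] sets.sigma_sets_subset[OF assms(3)]
  by (auto simp: subalgebra_def space_measure_of)

lemma sigma_finite_subalgebraI:
  assumes "subalgebra M F"
  shows "sigma_finite_subalgebra M F"
proof -
  interpret finite_measure_subalgebra M F
    by unfold_locales (rule assms)
  show ?thesis by (rule sigma_finite_subalgebra_axioms)
qed

lemma set_integral_indicator:
  "A \<in> events \<Longrightarrow> B \<in> events \<Longrightarrow> (\<integral>x\<in>A. indicator B x \<partial>M) = prob (A \<inter> B)"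
  unfolding set_lebesgue_integral_def by (simp flip: indicator_inter_arith)

lemma set_integral_const_on:
  assumes "A \<in> events" "\<And>x. x \<in> A \<Longrightarrow> h x = (c :: real)"
  shows "(\<integral>x\<in>A. h x \<partial>M) = c * prob A"
proof -
  have "(\<integral>x\<in>A. h x \<partial>M) = (\<integral>x. c * indicator A x \<partial>M)"
    unfolding set_lebesgue_integral_def using assms
    by (intro Bochner_Integration.integral_cong) (auto simp: indicator_def)
  then show ?thesis using assms(1) by simp
qed

text \<open>Conditional independence given a countable partition, cell by cell. One direction
  extracts numbers from the given Markov property, the other establishes the new one.\<close>

lemma cond_exp_partition_eq_iff:
  assumes \<beta>: "countable_measurable_partition M \<beta>"
    and F: "subalgebra M F" and \<beta>F: "\<beta> \<subseteq> sets F" and B: "B \<in> events"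
  shows "(AE x in M. real_cond_exp M F (indicator B) x =
            real_cond_exp M (sigma (space M) \<beta>) (indicator B) x) \<longleftrightarrow>
         (\<forall>b\<in>\<beta>. \<forall>D\<in>sets F. prob (D \<inter> B \<inter> b) * prob b = prob (D \<inter> b) * prob (B \<inter> b))"
    (is "?L \<longleftrightarrow> ?R")
proof -
  let ?\<Sigma> = "sigma (space M) \<beta>"
  let ?h = "real_cond_exp M ?\<Sigma> (indicator B)"
  have sub: "subalgebra F ?\<Sigma>"
    using subalgebra_sigma_partition[OF \<beta> F \<beta>F] .
  then have sub': "subalgebra M ?\<Sigma>" using F by (auto simp: subalgebra_def)
  interpret F: sigma_finite_subalgebra M F using sigma_finite_subalgebraI[OF F] .
  interpret \<Sigma>: sigma_finite_subalgebra M ?\<Sigma> using sigma_finite_subalgebraI[OF sub'] .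
  have FM: "D \<in> sets F \<Longrightarrow> D \<in> events" for D using F by (auto simp: subalgebra_def)
  have \<beta>\<Sigma>: "b \<in> sets ?\<Sigma>" if "b \<in> \<beta>" for b
    using that partition_subset_Pow[OF \<beta>] by (simp add: sets_measure_of sigma_sets.Basic)
  have intB: "integrable M (indicator B :: _ \<Rightarrow> real)" using B by (simp add: integrable_indicator_iff less_top[symmetric])
  \<comment> \<open>Measurability forces \<open>?h\<close> to be constant on each cell, so any point
    of the cell gives its value.\<close>
  define c where "c b = ?h (SOME x. x \<in> b)" for b
  have h_c: "?h x = c b" if "b \<in> \<beta>" "x \<in> b" for x b
    unfolding c_def using that
    by (intro measurable_sigma_partition_const[OF \<beta> borel_measurable_cond_exp]) (auto intro: someI)
  have c_prob: "prob (B \<inter> b) = c b * prob b" if "b \<in> \<beta>" for b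
  proof -
    have "prob (B \<inter> b) = (\<integral>x\<in>b. indicator B x \<partial>M)"
      using set_integral_indicator[of b B] B partition_events[OF \<beta> that] by (simp add: Int_commute)
    also have "\<dots> = (\<integral>x\<in>b. ?h x \<partial>M)"
      using \<Sigma>.real_cond_exp_intA[OF intB \<beta>\<Sigma>[OF that]] .
    also have "\<dots> = c b * prob b"
      using set_integral_const_on[OF partition_events[OF \<beta> that]] h_c that by blast
    finally show ?thesis .
  qed
  show ?thesis
  proof
    assume L: ?L
    show ?R
    proof (intro ballI)
      fix b D assume b: "b \<in> \<beta>" and D: "D \<in> sets F"
      have Db: "D \<inter> b \<in> sets F" using b D \<beta>F by auto
      have "prob (D \<inter> B \<inter> b) = (\<integral>x\<in>D \<inter> b. indicator B x \<partial>M)"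
        using set_integral_indicator[OF FM[OF Db] B] by (simp add: Int_ac)
      also have "\<dots> = (\<integral>x\<in>D \<inter> b. real_cond_exp M F (indicator B) x \<partial>M)"
        using F.real_cond_exp_intA[OF intB Db] .
      also have "\<dots> = (\<integral>x\<in>D \<inter> b. ?h x \<partial>M)"
        unfolding set_lebesgue_integral_def using L FM[OF Db]
        by (intro integral_cong_AE) auto
      also have "\<dots> = c b * prob (D \<inter> b)"
        using set_integral_const_on[OF FM[OF Db]] h_c[OF b] by blast
      finally show "prob (D \<inter> B \<inter> b) * prob b = prob (D \<inter> b) * prob (B \<inter> b)"
        using c_prob[OF b] by simp
    qed
  next
    assume R: ?R
    \<comment> \<open>Within a cell, the conditional expectation of the indicator of
      \<open>b \<inter> B\<close> is computed twice: by pulling out the indicator of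
      \<open>b\<close>, and by checking integrals against \<open>c b\<close> times that indicator.
      Countably many exceptional null sets are then united.\<close>
    have "AE x in M. x \<in> b \<longrightarrow> real_cond_exp M F (indicator B) x = ?h x" if b: "b \<in> \<beta>" for b
    proof -
      have bF: "b \<in> sets F" using b \<beta>F by auto
      have "AE x in M. real_cond_exp M F (\<lambda>x. indicator b x * indicator B x) x =
          indicator b x * real_cond_exp M F (indicator B) x"
        using bF B FM[OF bF] integrable_real_mult_indicator[OF FM[OF bF] intB]
        by (intro F.real_cond_exp_mult) (auto simp: mult.commute)
      moreover have "AE x in M. real_cond_exp M F (\<lambda>x. indicator b x * indicator B x) x =
          c b * indicator b x"
      proof (rule F.real_cond_exp_charact)
        fix D assume D: "D \<in> sets F"
        have "(\<integral>x\<in>D. indicator b x * indicator B x \<partial>M) = prob (D \<inter> B \<inter> b)"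
          using set_integral_indicator[of D "b \<inter> B"] FM[OF D] FM[OF bF] B
          by (simp add: indicator_inter_arith Int_ac mult.commute)
        also have "\<dots> = c b * prob (D \<inter> b)"
        proof (cases "prob b = 0")
          case True
          have "prob (D \<inter> B \<inter> b) \<le> prob b" "prob (D \<inter> b) \<le> prob b"
            using FM[OF bF] by (auto intro!: finite_measure_mono)
          then show ?thesis using True by (simp add: measure_le_0_iff)
        next
          case False
          have "prob (D \<inter> B \<inter> b) * prob b = c b * prob (D \<inter> b) * prob b"
            using R[rule_format, OF b D] c_prob[OF b] by (simp add: mult_ac)
          then show ?thesis using False by simp
        qed
        also have "\<dots> = (\<integral>x\<in>D. c b * indicator b x \<partial>M)"
          using set_integral_indicator[of D b] FM[OF D] FM[OF bF] by simp
        finally show "(\<integral>x\<in>D. indicator b x * indicator B x \<partial>M) =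
            (\<integral>x\<in>D. c b * indicator b x \<partial>M)" .
      qed (use bF FM[OF bF] B integrable_real_mult_indicator[OF FM[OF bF] intB] in
          \<open>auto simp: mult.commute integrable_indicator_iff less_top[symmetric]\<close>)
      ultimately show ?thesis
        by eventually_elim (auto simp: h_c[OF b])
    qed
    then have "AE x in M. \<forall>b\<in>\<beta>. x \<in> b \<longrightarrow> real_cond_exp M F (indicator B) x = ?h x"
      using \<beta> by (intro AE_ball_countable[THEN iffD2]) (auto simp: countable_measurable_partition_def)
    moreover have "AE x in M. x \<in> \<Union>\<beta>"
      using \<beta> by (intro AE_I2) (auto simp: countable_measurable_partition_def partition_on_def)
    ultimately show ?L
      by eventually_elim auto
  qed
qed

end

section \<open>Entropy of joins\<close>

text \<open>This is \<open>ln t \<le> t - 1\<close> at \<open>t = p * q / r\<close>, with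
  \<open>r\<close> a joint mass and \<open>p\<close>, \<open>q\<close> its marginals. It is the
  pointwise form of subadditivity of entropy.\<close>

lemma neg_mult_ln_le:
  fixes p q r :: real
  assumes "0 \<le> r" "r \<le> p" "r \<le> q"
  shows "- r * ln r \<le> r * - ln p + r * - ln q + p * q"
proof (cases "r = 0")
  case False
  then have pos: "0 < r" "0 < p" "0 < q" using assms by auto
  have "ln (p * q / r) \<le> p * q / r - 1"
    using pos by (intro ln_le_minus_one) auto
  then have "r * ln (p * q / r) \<le> r * (p * q / r - 1)"
    using pos by (intro mult_left_mono) auto
  also have "\<dots> \<le> p * q" using pos by (simp add: right_diff_distrib)
  finally show ?thesis
    using pos by (simp add: ln_mult ln_div right_diff_distrib distrib_left)
qed (use assms in simp)

text \<open>Empty intersections are dropped because \<open>partition_on\<close> admits no empty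
  block.\<close>

definition partition_join :: "'a set set \<Rightarrow> 'a set set \<Rightarrow> 'a set set" where
  "partition_join \<alpha> \<beta> = (\<lambda>(a, b). a \<inter> b) ` (\<alpha> \<times> \<beta>) - {{}}"

context prob_space
begin

lemma sum_partition_le:
  assumes "countable_measurable_partition M \<beta>" "finite B" "B \<subseteq> \<beta>" "a \<in> events"
  shows "(\<Sum>b\<in>B. prob (a \<inter> b)) \<le> prob a"
proof -
  have "disjoint \<beta>" using assms(1) by (simp add: countable_measurable_partition_def partition_on_def)
  then have "disjoint_family_on (\<lambda>b. a \<inter> b) B"
    using assms(3) unfolding disjoint_family_on_def disjoint_def by blast
  then have "(\<Sum>b\<in>B. prob (a \<inter> b)) = prob (\<Union>b\<in>B. a \<inter> b)"
    using assms partition_events[OF assms(1)]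
    by (intro finite_measure_finite_Union[symmetric]) auto
  also have "\<dots> \<le> prob a"
    using assms(4) by (intro finite_measure_mono) auto
  finally show ?thesis .
qed

lemma neg_mult_ln_prob_nonneg: "0 \<le> - prob A * ln (prob A)"
  by (cases "prob A = 0") (auto intro!: mult_nonneg_nonpos simp: zero_less_measure_iff)

lemma sum_neg_mult_ln_le_entropy:
  assumes "finite A" "A \<subseteq> \<alpha>"
  shows "ennreal (\<Sum>a\<in>A. - prob a * ln (prob a)) \<le> shannon_entropy M \<alpha>"
proof -
  have "ennreal (\<Sum>a\<in>A. - prob a * ln (prob a)) = (\<Sum>a\<in>A. ennreal (- prob a * ln (prob a)))"
    using neg_mult_ln_prob_nonneg by (intro sum_ennreal[symmetric])
  also have "\<dots> \<le> shannon_entropy M \<alpha>"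
    unfolding shannon_entropy_def using assms
    by (subst nonneg_infsum_complete) (auto intro!: SUP_upper)
  finally show ?thesis .
qed

text \<open>The 1 pays for truncation: over a finite rectangle of pairs the excess of
  \<open>p * q\<close> over \<open>r\<close> need not sum to at most zero, but the products
  \<open>p * q\<close> sum to at most 1. Only finiteness of the bound is used later.\<close>

lemma shannon_entropy_join_le:
  assumes \<alpha>: "countable_measurable_partition M \<alpha>" and \<beta>: "countable_measurable_partition M \<beta>"
  shows "shannon_entropy M (partition_join \<alpha> \<beta>) \<le> shannon_entropy M \<alpha> + shannon_entropy M \<beta> + 1"
proof -
  let ?\<eta> = "\<lambda>a. - prob a * ln (prob a)"
  have "(\<Sum>c\<in>K. ennreal (?\<eta> c)) \<le> shannon_entropy M \<alpha> + shannon_entropy M \<beta> + 1"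
    if K: "finite K" "K \<subseteq> partition_join \<alpha> \<beta>" for K
  proof -
    have "K \<subseteq> (\<lambda>(a, b). a \<inter> b) ` (\<alpha> \<times> \<beta>)" using K(2) by (auto simp: partition_join_def)
    \<comment> \<open>One pair is chosen for each block of \<open>K\<close>, so that the sum over
      \<open>K\<close> embeds into a sum over the rectangle \<open>A \<times> B\<close>.\<close>
    then obtain U where U: "U \<subseteq> \<alpha> \<times> \<beta>" "inj_on (\<lambda>(a, b). a \<inter> b) U" "K = (\<lambda>(a, b). a \<inter> b) ` U"
      by (auto simp: subset_image_inj)
    define A B where "A = fst ` U" and "B = snd ` U"
    have fU: "finite U" using U(2,3) K(1) finite_image_iff by blast
    then have fin: "finite A" "finite B" by (auto simp: A_def B_def)
    have AB: "A \<subseteq> \<alpha>" "B \<subseteq> \<beta>" "U \<subseteq> A \<times> B"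
      using U(1) by (auto simp: A_def B_def rev_image_eqI)
    have ev: "\<And>a. a \<in> A \<Longrightarrow> a \<in> events" "\<And>b. b \<in> B \<Longrightarrow> b \<in> events"
      using AB partition_events[OF \<alpha>] partition_events[OF \<beta>] by auto
    have "(\<Sum>c\<in>K. ?\<eta> c) = (\<Sum>(a,b)\<in>U. ?\<eta> (a \<inter> b))"
      unfolding U(3) using U(2) by (subst sum.reindex) (auto simp: case_prod_unfold)
    also have "\<dots> \<le> (\<Sum>(a,b)\<in>A \<times> B. ?\<eta> (a \<inter> b))"
      using AB fin neg_mult_ln_prob_nonneg by (intro sum_mono2) auto
    also have "\<dots> \<le> (\<Sum>(a,b)\<in>A \<times> B. prob (a \<inter> b) * - ln (prob a) + prob (a \<inter> b) * - ln (prob b)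
        + prob a * prob b)"
      unfolding case_prod_unfold using ev
      by (intro sum_mono neg_mult_ln_le finite_measure_mono) auto
    also have "\<dots> = (\<Sum>a\<in>A. (\<Sum>b\<in>B. prob (a \<inter> b)) * - ln (prob a))
        + (\<Sum>b\<in>B. (\<Sum>a\<in>A. prob (b \<inter> a)) * - ln (prob b)) + (\<Sum>a\<in>A. prob a) * (\<Sum>b\<in>B. prob b)"
      unfolding sum_product unfolding sum.cartesian_product[symmetric] sum.distrib sum_distrib_right
      by (subst (2) sum.swap) (simp only: Int_commute)
    also have "\<dots> \<le> (\<Sum>a\<in>A. ?\<eta> a) + (\<Sum>b\<in>B. ?\<eta> b) + 1 * 1"
    proof (intro add_mono sum_mono)
      \<comment> \<open>Null sets are covered by the convention \<open>ln 0 = 0\<close>.\<close>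
      have neg: "0 \<le> - ln (prob a)" for a
        by (cases "prob a = 0") (auto simp: zero_less_measure_iff)
      show "(\<Sum>b\<in>B. prob (a \<inter> b)) * - ln (prob a) \<le> ?\<eta> a" if "a \<in> A" for a
        using mult_right_mono[OF sum_partition_le[OF \<beta> fin(2) AB(2) ev(1)[OF that]] neg[of a]] by simp
      show "(\<Sum>a\<in>A. prob (b \<inter> a)) * - ln (prob b) \<le> ?\<eta> b" if "b \<in> B" for b
        using mult_right_mono[OF sum_partition_le[OF \<alpha> fin(1) AB(1) ev(2)[OF that]] neg[of b]] by simp
      have "(\<Sum>a\<in>A. prob (space M \<inter> a)) \<le> 1" "(\<Sum>b\<in>B. prob (space M \<inter> b)) \<le> 1"
        using sum_partition_le[OF \<alpha> fin(1) AB(1) sets.top]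
          sum_partition_le[OF \<beta> fin(2) AB(2) sets.top] by (auto simp: prob_space)
      then have "(\<Sum>a\<in>A. prob a) \<le> 1" "(\<Sum>b\<in>B. prob b) \<le> 1"
        using ev by (auto simp: Int_absorb1 sets.sets_into_space cong: sum.cong)
      then show "(\<Sum>a\<in>A. prob a) * (\<Sum>b\<in>B. prob b) \<le> 1 * 1"
        by (intro mult_mono) (auto simp: sum_nonneg)
    qed
    finally have "ennreal (\<Sum>c\<in>K. ?\<eta> c) \<le> ennreal ((\<Sum>a\<in>A. ?\<eta> a) + (\<Sum>b\<in>B. ?\<eta> b) + 1)"
      by (intro ennreal_leI) simp
    also have "\<dots> = ennreal (\<Sum>a\<in>A. ?\<eta> a) + ennreal (\<Sum>b\<in>B. ?\<eta> b) + 1"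
    proof -
      have "0 \<le> (\<Sum>a\<in>A. ?\<eta> a)" "0 \<le> (\<Sum>b\<in>B. ?\<eta> b)"
        by (intro sum_nonneg neg_mult_ln_prob_nonneg)+
      then show ?thesis by (simp only: ennreal_plus ennreal_1 add_nonneg_nonneg zero_le_one)
    qed
    also have "\<dots> \<le> shannon_entropy M \<alpha> + shannon_entropy M \<beta> + 1"
      using sum_neg_mult_ln_le_entropy fin AB by (intro add_mono) auto
    finally show ?thesis
      using neg_mult_ln_prob_nonneg by (subst sum_ennreal) auto
  qed
  then show ?thesis
    unfolding shannon_entropy_def[of M "partition_join \<alpha> \<beta>"]
    by (intro infsum_le_finite_sums nonneg_summable_on_complete) auto
qed

end

section \<open>Processes with countably many values\<close>

text \<open>The value type is left open: it is \<open>bool\<close> for events and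
  \<open>ennreal\<close> for the weights of a factorization.\<close>

definition depends_on :: "'v set \<Rightarrow> (('v \<Rightarrow> 'l) \<Rightarrow> 'b) \<Rightarrow> bool" where
  "depends_on W p \<longleftrightarrow> (\<forall>x y. (\<forall>v\<in>W. x v = y v) \<longrightarrow> p x = p y)"

lemma depends_onD: "depends_on W p \<Longrightarrow> (\<And>v. v \<in> W \<Longrightarrow> x v = y v) \<Longrightarrow> p x = p y"
  by (auto simp: depends_on_def)

lemma depends_on_mono: "depends_on W p \<Longrightarrow> W \<subseteq> W' \<Longrightarrow> depends_on W' p"
  by (auto simp: depends_on_def subset_eq)

lemma depends_on_conj: "depends_on W p \<Longrightarrow> depends_on W' q \<Longrightarrow> depends_on (W \<union> W') (\<lambda>x. p x \<and> q x)"
  by (simp add: depends_on_def) (metis UnCI)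

lemma depends_on_cylinder: "depends_on W (\<lambda>x. \<forall>v\<in>W. x v = c v)"
  by (auto simp: depends_on_def)

locale countable_process = prob_space M for M :: "'a measure" +
  fixes L :: "'l set" and Y :: "'v \<Rightarrow> 'a \<Rightarrow> 'l"
  assumes countable_L: "countable L"
    and Y_in: "\<omega> \<in> space M \<Longrightarrow> Y v \<omega> \<in> L"
    and Y_measurable: "{\<omega> \<in> space M. Y v \<omega> = l} \<in> sets M"
begin

definition event :: "(('v \<Rightarrow> 'l) \<Rightarrow> bool) \<Rightarrow> 'a set" where
  "event p = {\<omega> \<in> space M. p (\<lambda>v. Y v \<omega>)}"

definition cyl :: "'v set \<Rightarrow> ('v \<Rightarrow> 'l) \<Rightarrow> 'a set" where
  "cyl W c = event (\<lambda>x. \<forall>v\<in>W. x v = c v)"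

lemma event_Int: "event p \<inter> event q = event (\<lambda>x. p x \<and> q x)"
  by (auto simp: event_def)

lemma cyl_events: "finite W \<Longrightarrow> cyl W c \<in> events"
proof (induction W rule: finite_induct)
  case (insert v W)
  have "cyl (insert v W) c = {\<omega> \<in> space M. Y v \<omega> = c v} \<inter> cyl W c"
    by (auto simp: cyl_def event_def)
  then show ?case using insert Y_measurable by auto
qed (simp add: cyl_def event_def)

lemma countable_labelings: "finite W \<Longrightarrow> countable (W \<rightarrow>\<^sub>E L)"
  using countable_L by (intro countable_PiE)

lemma event_eq_UN_cyl:
  assumes "depends_on W p"
  shows "event p = (\<Union>c\<in>{c \<in> W \<rightarrow>\<^sub>E L. p c}. cyl W c)"
proof -
  have "p (\<lambda>v. Y v \<omega>) \<longleftrightarrow> (\<exists>c\<in>W \<rightarrow>\<^sub>E L. p c \<and> (\<forall>v\<in>W. Y v \<omega> = c v))"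
    if "\<omega> \<in> space M" for \<omega>
  proof
    assume "p (\<lambda>v. Y v \<omega>)"
    moreover have "p (\<lambda>v. Y v \<omega>) = p (restrict (\<lambda>v. Y v \<omega>) W)"
      using assms by (rule depends_onD) auto
    ultimately show "\<exists>c\<in>W \<rightarrow>\<^sub>E L. p c \<and> (\<forall>v\<in>W. Y v \<omega> = c v)"
      using Y_in[OF that] by (intro bexI[of _ "restrict (\<lambda>v. Y v \<omega>) W"]) auto
  next
    assume "\<exists>c\<in>W \<rightarrow>\<^sub>E L. p c \<and> (\<forall>v\<in>W. Y v \<omega> = c v)"
    then obtain c where "p c" "\<forall>v\<in>W. Y v \<omega> = c v" by auto
    then show "p (\<lambda>v. Y v \<omega>)" using depends_onD[OF assms, of "\<lambda>v. Y v \<omega>" c] by auto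
  qed
  then have "\<omega> \<in> event p \<longleftrightarrow> \<omega> \<in> (\<Union>c\<in>{c \<in> W \<rightarrow>\<^sub>E L. p c}. cyl W c)" for \<omega>
    unfolding event_def cyl_def by blast
  then show ?thesis by blast
qed

lemma event_events:
  assumes "finite W" "depends_on W p"
  shows "event p \<in> events"
  unfolding event_eq_UN_cyl[OF assms(2)]
  using countable_labelings[OF assms(1)] cyl_events[OF assms(1)]
  by (intro sets.countable_UN') (auto intro: countable_subset)

text \<open>Total probability as an integral over counting measure: in \<open>ennreal\<close> a
  double sum of products then factors with no summability to check.\<close>

lemma emeasure_split:
  assumes "finite W" "E \<in> events"
  shows "emeasure M E = (\<integral>\<^sup>+c. emeasure M (E \<inter> cyl W c) \<partial>count_space (W \<rightarrow>\<^sub>E L))"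
proof -
  have "event (\<lambda>_. True) = (\<Union>c\<in>W \<rightarrow>\<^sub>E L. cyl W c)"
    by (subst event_eq_UN_cyl[of W]) (auto simp: depends_on_def)
  then have "E = (\<Union>c\<in>W \<rightarrow>\<^sub>E L. E \<inter> cyl W c)"
    using sets.sets_into_space[OF assms(2)] by (auto simp: event_def)
  moreover have "disjoint_family_on (\<lambda>c. E \<inter> cyl W c) (W \<rightarrow>\<^sub>E L)"
  proof (unfold disjoint_family_on_def, intro ballI impI, rule ccontr)
    fix c d assume cd: "c \<in> W \<rightarrow>\<^sub>E L" "d \<in> W \<rightarrow>\<^sub>E L" "c \<noteq> d"
      and "(E \<inter> cyl W c) \<inter> (E \<inter> cyl W d) \<noteq> {}"
    then obtain \<omega> where "\<omega> \<in> cyl W c" "\<omega> \<in> cyl W d" by auto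
    then have "\<forall>v\<in>W. c v = d v" by (auto simp: cyl_def event_def)
    then show False using cd by (metis PiE_ext)
  qed
  ultimately show ?thesis
    using countable_labelings[OF assms(1)] cyl_events[OF assms(1)] assms(2)
    by (subst (1) \<open>E = _\<close>, intro emeasure_UN_countable) auto
qed

text \<open>As in a Markov random field, \<open>\<Phi>\<close> and \<open>\<Psi>\<close> are mere
  weights: they need not be normalized, and both may see the coordinates in
  \<open>A \<inter> B\<close>. In this form, adding a leaf only multiplies one of the two
  weights.\<close>

definition factors :: "'v set \<Rightarrow> 'v set \<Rightarrow> 'v set \<Rightarrow> bool" where
  "factors A B N \<longleftrightarrow> (\<exists>\<Phi> \<Psi>. depends_on (A \<inter> N) \<Phi> \<and> depends_on (B \<inter> N) \<Psi> \<and>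
     (\<forall>x. emeasure M (cyl N x) = \<Phi> x * \<Psi> x))"

lemma factors_sym: "factors A B N \<Longrightarrow> factors B A N"
  unfolding factors_def by (metis mult.commute)

lemma factors_singleton:
  assumes "r \<in> A \<union> B"
  shows "factors A B {r}"
proof -
  have *: "factors A B {r}" if "r \<in> A" for A B
    unfolding factors_def
  proof (intro exI conjI allI)
    show "depends_on (A \<inter> {r}) (\<lambda>x. emeasure M (cyl {r} x))"
      using that by (auto simp: depends_on_def cyl_def)
    show "depends_on (B \<inter> {r}) (\<lambda>x. 1 :: ennreal)" by (auto simp: depends_on_def)
  qed simp
  from assms consider "r \<in> A" | "r \<in> B" by auto
  then show ?thesis
    using * factors_sym by cases blast+
qed

lemma factors_insert_left:
  assumes N: "factors A B N" "finite N" and u: "u \<in> N" and uv: "u \<in> A" "v \<in> A"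
    and leaf: "\<And>x. prob (cyl (insert v N) x) * prob (cyl {u} x) = prob (cyl N x) * prob (cyl {u, v} x)"
  shows "factors A B (insert v N)"
proof -
  obtain \<Phi> \<Psi> where \<Phi>: "depends_on (A \<inter> N) \<Phi>" and \<Psi>: "depends_on (B \<inter> N) \<Psi>"
    and eq: "\<And>x. emeasure M (cyl N x) = \<Phi> x * \<Psi> x"
    using N(1) unfolding factors_def by auto
  \<comment> \<open>The transition probability from the label at \<open>u\<close> to that at
    \<open>v\<close>. If the label at \<open>u\<close> has probability zero, division by zero makes
    it 0, which agrees with the null cylinder over the larger window.\<close>
  define k where "k x = ennreal (prob (cyl {u, v} x) / prob (cyl {u} x))" for x
  have "emeasure M (cyl (insert v N) x) = (\<Phi> x * k x) * \<Psi> x" for x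
  proof -
    have "prob (cyl (insert v N) x) = prob (cyl N x) * (prob (cyl {u, v} x) / prob (cyl {u} x))"
    proof (cases "prob (cyl {u} x) = 0")
      case True
      have "cyl (insert v N) x \<subseteq> cyl {u} x" using u by (auto simp: cyl_def event_def)
      then have "prob (cyl (insert v N) x) \<le> prob (cyl {u} x)"
        using cyl_events[of "{u}"] by (intro finite_measure_mono) auto
      then show ?thesis using True by (simp add: measure_le_0_iff)
    next
      case False
      then show ?thesis using leaf[of x] by (simp add: field_simps)
    qed
    then have "emeasure M (cyl (insert v N) x) = emeasure M (cyl N x) * k x"
      by (simp add: emeasure_eq_measure k_def ennreal_mult' flip: ennreal_mult)
    then show ?thesis by (simp add: eq mult_ac)
  qed
  moreover have "depends_on (A \<inter> insert v N) (\<lambda>x. \<Phi> x * k x)"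
  proof (unfold depends_on_def, intro allI impI)
    fix x y :: "'v \<Rightarrow> 'l" assume a: "\<forall>w\<in>A \<inter> insert v N. x w = y w"
    then have "\<Phi> x = \<Phi> y" by (intro depends_onD[OF \<Phi>]) auto
    moreover have "x u = y u" "x v = y v" using a u uv by auto
    ultimately show "\<Phi> x * k x = \<Phi> y * k y" by (simp add: k_def cyl_def)
  qed
  moreover have "depends_on (B \<inter> insert v N) \<Psi>"
    using \<Psi> by (rule depends_on_mono) auto
  ultimately show ?thesis unfolding factors_def by blast
qed

lemma factors_insert:
  assumes "factors A B N" "finite N" "u \<in> N" "{u, v} \<subseteq> A \<or> {u, v} \<subseteq> B"
    and "\<And>x. prob (cyl (insert v N) x) * prob (cyl {u} x) = prob (cyl N x) * prob (cyl {u, v} x)"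
  shows "factors A B (insert v N)"
  using assms factors_insert_left[of A B N u v] factors_insert_left[of B A N u v] factors_sym
  by blast

text \<open>With the labels on \<open>A \<inter> B\<close> frozen to \<open>c\<close>, the remaining
  coordinates of \<open>A\<close> and \<open>B\<close> are disjoint, so the sum over them splits
  into a product. The overlay \<open>ov\<close> puts \<open>c\<close> on top of a labelling of one
  side.\<close>

lemma factors_emeasure_sum_out:
  assumes N: "finite N" "N \<subseteq> A \<union> B" "A \<inter> B \<subseteq> N"
    and \<Phi>: "depends_on (A \<inter> N) \<Phi>" and \<Psi>: "depends_on (B \<inter> N) \<Psi>"
    and eq: "\<And>x. emeasure M (cyl N x) = \<Phi> x * \<Psi> x"
    and p: "depends_on (A \<inter> N) p" and q: "depends_on (B \<inter> N) q"
  defines "ov \<equiv> \<lambda>c a v. if v \<in> A \<inter> B then c v else a v"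
  shows "emeasure M (event p \<inter> event q \<inter> cyl (A \<inter> B) c) =
    (\<integral>\<^sup>+a. (if p (ov c a) then \<Phi> (ov c a) else 0) \<partial>count_space ((A - B) \<inter> N \<rightarrow>\<^sub>E L)) *
    (\<integral>\<^sup>+b. (if q (ov c b) then \<Psi> (ov c b) else 0) \<partial>count_space ((B - A) \<inter> N \<rightarrow>\<^sub>E L))"
proof -
  let ?P = "(A - B) \<inter> N" and ?Q = "(B - A) \<inter> N" and ?F = "A \<inter> B"
  let ?f = "\<lambda>a. if p (ov c a) then \<Phi> (ov c a) else 0"
  let ?g = "\<lambda>b. if q (ov c b) then \<Psi> (ov c b) else 0"
  let ?E = "event p \<inter> event q \<inter> cyl ?F c"
  have finF: "finite ?F" using N finite_subset by blast
  have E: "?E \<in> events"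
    using event_events[OF _ p] event_events[OF _ q] cyl_events[OF finF] N(1) by auto
  have atom: "emeasure M (?E \<inter> cyl ?P a \<inter> cyl ?Q b) = ?f a * ?g b" for a b
  proof -
    \<comment> \<open>The labelling glued from \<open>c\<close>, \<open>a\<close> and
      \<open>b\<close>; the hypotheses on \<open>N\<close> make their three domains a decomposition
      of \<open>N\<close>.\<close>
    define x where "x v = (if v \<in> ?F then c v else if v \<in> A then a v else b v)" for v
    have cyl_x: "cyl ?F c \<inter> cyl ?P a \<inter> cyl ?Q b = cyl N x"
    proof -
      have eqv: "(\<forall>v\<in>?F. y v = c v) \<and> (\<forall>v\<in>?P. y v = a v) \<and> (\<forall>v\<in>?Q. y v = b v) \<longleftrightarrow>
          (\<forall>v\<in>N. y v = x v)" for y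
        unfolding x_def using N by (auto split: if_splits)
      then have "\<omega> \<in> cyl ?F c \<inter> cyl ?P a \<inter> cyl ?Q b \<longleftrightarrow> \<omega> \<in> cyl N x" for \<omega>
        using eqv[of "\<lambda>v. Y v \<omega>"] unfolding cyl_def event_def by blast
      then show ?thesis by blast
    qed
    have ax: "v \<in> A \<inter> N \<Longrightarrow> ov c a v = x v" and bx: "v \<in> B \<inter> N \<Longrightarrow> ov c b v = x v" for v
      by (auto simp: ov_def x_def)
    have px: "p (ov c a) = p x" and \<Phi>x: "\<Phi> (ov c a) = \<Phi> x"
      and qx: "q (ov c b) = q x" and \<Psi>x: "\<Psi> (ov c b) = \<Psi> x"
      by (rule depends_onD[OF p ax] depends_onD[OF \<Phi> ax] depends_onD[OF q bx] depends_onD[OF \<Psi> bx];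
          assumption)+
    have pY: "p (\<lambda>v. Y v \<omega>) = p x" and qY: "q (\<lambda>v. Y v \<omega>) = q x" if "\<omega> \<in> cyl N x" for \<omega>
      using that by (auto simp: cyl_def event_def intro!: depends_onD[OF p] depends_onD[OF q])
    have "?E \<inter> cyl ?P a \<inter> cyl ?Q b = event p \<inter> event q \<inter> cyl N x"
      using cyl_x by auto
    also have "\<dots> = (if p x \<and> q x then cyl N x else {})"
      using pY qY by (auto simp: event_def cyl_def)
    finally show ?thesis
      by (simp add: px qx \<Phi>x \<Psi>x eq)
  qed
  have "emeasure M ?E = (\<integral>\<^sup>+a. emeasure M (?E \<inter> cyl ?P a) \<partial>count_space (?P \<rightarrow>\<^sub>E L))"
    using N E by (intro emeasure_split) auto
  also have "\<dots> = (\<integral>\<^sup>+a. (\<integral>\<^sup>+b. ?f a * ?g b \<partial>count_space (?Q \<rightarrow>\<^sub>E L)) \<partial>count_space (?P \<rightarrow>\<^sub>E L))"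
    using N E cyl_events[of ?P]
    by (intro nn_integral_cong) (subst emeasure_split[of ?Q], auto simp: atom[simplified])
  also have "\<dots> = (\<integral>\<^sup>+a. ?f a \<partial>count_space (?P \<rightarrow>\<^sub>E L)) * (\<integral>\<^sup>+b. ?g b \<partial>count_space (?Q \<rightarrow>\<^sub>E L))"
    by (subst nn_integral_cmult, simp, subst nn_integral_multc) simp_all
  finally show ?thesis .
qed

text \<open>Summing out with each of \<open>p\<close>, \<open>q\<close> either kept or replaced by
  truth gives four products from the same pool of two left and two right factors; both sides
  multiply all four of these.\<close>

lemma factors_cond_indep:
  assumes "factors A B N" "finite N" "N \<subseteq> A \<union> B" "A \<inter> B \<subseteq> N"
    and p: "depends_on (A \<inter> N) p" and q: "depends_on (B \<inter> N) q"
  shows "prob (event p \<inter> event q \<inter> cyl (A \<inter> B) c) * prob (cyl (A \<inter> B) c) =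
         prob (event p \<inter> cyl (A \<inter> B) c) * prob (event q \<inter> cyl (A \<inter> B) c)"
proof -
  obtain \<Phi> \<Psi> where f: "depends_on (A \<inter> N) \<Phi>" "depends_on (B \<inter> N) \<Psi>"
      "\<And>x. emeasure M (cyl N x) = \<Phi> x * \<Psi> x"
    using assms(1) unfolding factors_def by auto
  note sum_out = factors_emeasure_sum_out[OF assms(2-4) f]
  have T: "depends_on W (\<lambda>_. True)" for W :: "'v set" by (auto simp: depends_on_def)
  have "event (\<lambda>_. True) \<inter> cyl (A \<inter> B) c = cyl (A \<inter> B) c"
    by (auto simp: event_def cyl_def)
  moreover have "event r \<inter> event (\<lambda>_. True) = event r" "event (\<lambda>_. True) \<inter> event r = event r" for r
    by (auto simp: event_def)
  ultimately have
    "emeasure M (event p \<inter> event q \<inter> cyl (A \<inter> B) c) * emeasure M (cyl (A \<inter> B) c) =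
     emeasure M (event p \<inter> cyl (A \<inter> B) c) * emeasure M (event q \<inter> cyl (A \<inter> B) c)"
    using sum_out[OF p q, of c] sum_out[OF p T, of c] sum_out[OF T q, of c] sum_out[OF T T, of c]
    by (simp add: mult_ac)
  then show ?thesis
    by (simp add: emeasure_eq_measure flip: ennreal_mult)
qed

end

section \<open>The process of an action and a partition\<close>

locale partition_action = prob_space M + group_action G "space M" \<phi>
  for G :: "('g, 'm) monoid_scheme" (structure) and M :: "'a measure" and \<phi> +
  fixes \<alpha> :: "'a set set"
  assumes pmp: "pmp_action G M \<phi>" and \<alpha>: "countable_measurable_partition M \<alpha>"
begin

sublocale group G
  using group_hom by (rule group_hom.axioms)

section \<open>Translates, labels and stationarity\<close>

lemma act_measurable: "g \<in> carrier G \<Longrightarrow> \<phi> g \<in> measurable M M"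
  and distr_act: "g \<in> carrier G \<Longrightarrow> distr M M (\<phi> g) = M"
  using pmp by (auto simp: pmp_action_def)

lemma act_space: "g \<in> carrier G \<Longrightarrow> \<omega> \<in> space M \<Longrightarrow> \<phi> g \<omega> \<in> space M"
  using element_image by blast

lemma act_one: "\<omega> \<in> space M \<Longrightarrow> \<phi> \<one> \<omega> = \<omega>"
  using id_eq_one by (metis restrict_apply')

lemma act_image:
  assumes "g \<in> carrier G" "A \<subseteq> space M"
  shows "\<phi> g ` A = {\<omega> \<in> space M. \<phi> (inv g) \<omega> \<in> A}"
proof
  show "\<phi> g ` A \<subseteq> {\<omega> \<in> space M. \<phi> (inv g) \<omega> \<in> A}"
    using assms act_space orbit_sym_aux[OF assms(1)] by (auto simp: subset_eq)
  show "{\<omega> \<in> space M. \<phi> (inv g) \<omega> \<in> A} \<subseteq> \<phi> g ` A"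
  proof
    fix \<omega> assume "\<omega> \<in> {\<omega> \<in> space M. \<phi> (inv g) \<omega> \<in> A}"
    then have \<omega>: "\<omega> \<in> space M" "\<phi> (inv g) \<omega> \<in> A" by auto
    have "\<phi> g (\<phi> (inv g) \<omega>) = \<omega>"
      using composition_rule[of \<omega> g "inv g"] \<omega> assms(1) by (simp add: act_one)
    then show "\<omega> \<in> \<phi> g ` A" using \<omega>(2) by (metis imageI)
  qed
qed

lemma act_image_events:
  assumes "g \<in> carrier G" "A \<in> events"
  shows "\<phi> g ` A \<in> events"
proof -
  have "\<phi> g ` A = \<phi> (inv g) -` A \<inter> space M"
    using act_image[OF assms(1) sets.sets_into_space[OF assms(2)]] by auto
  then show ?thesis
    using measurable_sets[OF act_measurable[of "inv g"] assms(2)] assms(1) by simp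
qed

lemma prob_vimage_act:
  assumes "g \<in> carrier G" "A \<in> events"
  shows "prob (\<phi> g -` A \<inter> space M) = prob A"
  using measure_distr[OF act_measurable[OF assms(1)] assms(2)] by (simp add: distr_act[OF assms(1)])

lemma prob_act_image:
  assumes "g \<in> carrier G" "A \<in> events"
  shows "prob (\<phi> g ` A) = prob A"
proof -
  have "\<phi> g ` A = \<phi> (inv g) -` A \<inter> space M"
    using act_image[OF assms(1) sets.sets_into_space[OF assms(2)]] by auto
  then show ?thesis using prob_vimage_act[of "inv g" A] assms by simp
qed

lemma \<alpha>_space: "a \<in> \<alpha> \<Longrightarrow> a \<subseteq> space M"
  using partition_subset_Pow[OF \<alpha>] by auto

lemma ex1_cell:
  assumes "\<omega> \<in> space M"
  shows "\<exists>!a. a \<in> \<alpha> \<and> \<omega> \<in> a"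
proof -
  have U: "\<Union>\<alpha> = space M" and D: "disjoint \<alpha>"
    using \<alpha> by (auto simp: countable_measurable_partition_def partition_on_def)
  obtain a where a: "a \<in> \<alpha>" "\<omega> \<in> a" using U assms by auto
  show ?thesis
  proof (rule ex1I[of _ a])
    show "b = a" if "b \<in> \<alpha> \<and> \<omega> \<in> b" for b
      using disjointD[OF D, of b a] a that by blast
  qed (use a in simp)
qed

text \<open>
  \<open>label g \<omega>\<close> is the cell of \<open>g \<cdot> \<alpha>\<close> containing \<open>\<omega>\<close>, named by the corresponding cell of \<open>\<alpha>\<close>.
  The case \<open>g \<notin> carrier G\<close> only makes \<open>label\<close> a process indexed by the whole type.
\<close>

definition label :: "'g \<Rightarrow> 'a \<Rightarrow> 'a set" where
  "label g \<omega> = (THE a. a \<in> \<alpha> \<and> \<phi> (if g \<in> carrier G then inv g else \<one>) \<omega> \<in> a)"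

lemma label_in_and_mem:
  assumes "\<omega> \<in> space M"
  shows "label g \<omega> \<in> \<alpha> \<and> \<phi> (if g \<in> carrier G then inv g else \<one>) \<omega> \<in> label g \<omega>"
  unfolding label_def
  by (rule theI', rule ex1_cell, rule act_space) (use assms in auto)

lemma label_eq_iff:
  assumes "\<omega> \<in> space M" "a \<in> \<alpha>"
  shows "label g \<omega> = a \<longleftrightarrow> \<phi> (if g \<in> carrier G then inv g else \<one>) \<omega> \<in> a"
proof -
  have "\<phi> (if g \<in> carrier G then inv g else \<one>) \<omega> \<in> space M"
    by (rule act_space) (use assms in auto)
  then show ?thesis
    using ex1_cell label_in_and_mem[OF assms(1), of g] assms(2) by metis
qed

lemma label_level_set:
  assumes "g \<in> carrier G" "a \<in> \<alpha>"
  shows "{\<omega> \<in> space M. label g \<omega> = a} = \<phi> g ` a"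
  using assms label_eq_iff[OF _ assms(2), of _ g] \<alpha>_space[OF assms(2)] by (auto simp: act_image)

sublocale countable_process M \<alpha> label
proof
  show "countable \<alpha>" using \<alpha> by (simp add: countable_measurable_partition_def)
  show "label v \<omega> \<in> \<alpha>" if "\<omega> \<in> space M" for v \<omega> using label_in_and_mem[OF that] by simp
  show "{\<omega> \<in> space M. label v \<omega> = l} \<in> events" for v l
  proof (cases "l \<in> \<alpha>")
    case True
    let ?g = "if v \<in> carrier G then inv v else \<one>"
    have "{\<omega> \<in> space M. label v \<omega> = l} = \<phi> ?g -` l \<inter> space M"
      using label_eq_iff[OF _ True, of _ v] by blast
    also have "\<dots> \<in> events"
      using partition_events[OF \<alpha> True] by (intro measurable_sets[OF act_measurable]) auto
    finally show ?thesis .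
  next
    case False
    then have "{\<omega> \<in> space M. label v \<omega> = l} = {}" using label_in_and_mem by blast
    then show ?thesis by (metis sets.empty_sets)
  qed
qed

lemma cyl_singleton: "g \<in> carrier G \<Longrightarrow> c g \<in> \<alpha> \<Longrightarrow> cyl {g} c = \<phi> g ` c g"
  using label_level_set[of g "c g"] by (simp add: cyl_def event_def)

lemma cyl_empty:
  assumes "v \<in> W" "c v \<notin> \<alpha>"
  shows "cyl W c = {}"
proof (rule equals0I)
  fix \<omega> assume "\<omega> \<in> cyl W c"
  then have "\<omega> \<in> space M" "label v \<omega> = c v" using assms(1) by (simp_all add: cyl_def event_def)
  then show False using Y_in[of \<omega> v] assms(2) by simp
qed

lemma cyl_space: "cyl W c \<subseteq> space M"
  by (auto simp: cyl_def event_def)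

lemma label_act:
  assumes "g \<in> carrier G" "h \<in> carrier G" "\<omega> \<in> space M"
  shows "label h (\<phi> g \<omega>) = label (inv g \<otimes> h) \<omega>"
proof -
  have "\<phi> (inv h) (\<phi> g \<omega>) = \<phi> (inv (inv g \<otimes> h)) \<omega>"
    using assms by (simp add: inv_mult_group composition_rule)
  then show ?thesis using assms by (simp add: label_def)
qed

lemma vimage_act_cyl:
  assumes "g \<in> carrier G" "W \<subseteq> carrier G"
  shows "\<phi> g -` cyl W c \<inter> space M = cyl ((\<lambda>h. inv g \<otimes> h) ` W) (\<lambda>k. c (g \<otimes> k))"
proof -
  have "g \<otimes> (inv g \<otimes> h) = h" if "h \<in> W" for h
    using assms that by (simp add: m_assoc[symmetric] subset_eq)
  then show ?thesis
    using assms label_act act_space by (auto simp: cyl_def event_def subset_eq)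
qed

text \<open>It turns a translate by \<open>g\<close> of a block of \<open>cells F\<close> into a
  cylinder over the bag \<open>g F\<close>.\<close>

lemma act_image_cyl:
  assumes "g \<in> carrier G" "W \<subseteq> carrier G"
  shows "\<phi> g ` cyl W c = cyl ((\<lambda>h. g \<otimes> h) ` W) (\<lambda>k. c (inv g \<otimes> k))"
proof -
  have "\<phi> g ` cyl W c = \<phi> (inv g) -` cyl W c \<inter> space M"
    using act_image[OF assms(1) cyl_space] by auto
  then show ?thesis using vimage_act_cyl[of "inv g" W c] assms by simp
qed

text \<open>Stationarity of the labels: it carries the Markov condition, stated at
  \<open>\<one>\<close>, to the edges at every vertex.\<close>

lemma prob_cyl_shift:
  assumes "g \<in> carrier G" "W \<subseteq> carrier G" "finite W"
  shows "prob (cyl ((\<lambda>h. inv g \<otimes> h) ` W) (\<lambda>k. c (g \<otimes> k))) = prob (cyl W c)"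
  using prob_vimage_act[OF assms(1) cyl_events[OF assms(3)]] vimage_act_cyl[OF assms(1,2)] by simp

section \<open>Sigma-algebras generated by translates\<close>

lemma translates_Pow:
  assumes "F \<subseteq> carrier G" "countable_measurable_partition M \<beta>"
  shows "{\<phi> f ` A |f A. f \<in> F \<and> A \<in> \<beta>} \<subseteq> Pow (space M)"
proof -
  have "\<phi> f ` A \<in> events" if "f \<in> F" "A \<in> \<beta>" for f A
    using act_image_events partition_events[OF assms(2)] assms(1) that by auto
  then show ?thesis using sets.sets_into_space by blast
qed

lemma sets_translates:
  assumes "F \<subseteq> carrier G" "countable_measurable_partition M \<beta>"
  shows "sets (translates_algebra M \<phi> F \<beta>) =
    sigma_sets (space M) {\<phi> f ` A |f A. f \<in> F \<and> A \<in> \<beta>}"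
  using translates_Pow[OF assms] by (simp add: translates_algebra_def)

lemma space_translates [simp]: "space (translates_algebra M \<phi> F \<beta>) = space M"
  by (simp add: translates_algebra_def space_measure_of_conv)

lemma subalgebra_translates:
  assumes "F \<subseteq> carrier G" "countable_measurable_partition M \<beta>"
  shows "subalgebra M (translates_algebra M \<phi> F \<beta>)"
proof -
  have "{\<phi> f ` A |f A. f \<in> F \<and> A \<in> \<beta>} \<subseteq> events"
    using act_image_events partition_events[OF assms(2)] assms(1) by auto
  then show ?thesis
    unfolding subalgebra_def sets_translates[OF assms]
    by (simp add: sets.sigma_sets_subset)
qed

lemma translates_basic:
  assumes "F \<subseteq> carrier G" "countable_measurable_partition M \<beta>" "f \<in> F" "A \<in> \<beta>"
  shows "\<phi> f ` A \<in> sets (translates_algebra M \<phi> F \<beta>)"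
  unfolding sets_translates[OF assms(1,2)] using assms(3,4) by (auto intro: sigma_sets.Basic)

lemma partition_subset_translates:
  assumes "F \<subseteq> carrier G" "countable_measurable_partition M \<beta>" "\<one> \<in> F"
  shows "\<beta> \<subseteq> sets (translates_algebra M \<phi> F \<beta>)"
proof
  fix b assume b: "b \<in> \<beta>"
  then have "\<phi> \<one> ` b = b"
    using partition_subset_Pow[OF assms(2)] by (auto simp: act_one subset_eq image_iff)
  then show "b \<in> sets (translates_algebra M \<phi> F \<beta>)"
    using translates_basic[OF assms(1,2,3) b] by simp
qed

lemma cyl_in_translates:
  assumes "F \<subseteq> carrier G" "finite W" "W \<subseteq> F"
  shows "cyl W c \<in> sets (translates_algebra M \<phi> F \<alpha>)"
  using assms(2,3)
proof (induction W rule: finite_induct)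
  case empty
  have "cyl {} c = space (translates_algebra M \<phi> F \<alpha>)" by (simp add: cyl_def event_def)
  then show ?case by (metis sets.top)
next
  case (insert v W)
  have *: "cyl (insert v W) c = cyl {v} c \<inter> cyl W c" by (auto simp: cyl_def event_def)
  show ?case
  proof (cases "c v \<in> \<alpha>")
    case True
    then have "cyl {v} c \<in> sets (translates_algebra M \<phi> F \<alpha>)"
      using translates_basic[OF assms(1) \<alpha>, of v "c v"] cyl_singleton[of v c] insert.prems assms(1)
      by auto
    then show ?thesis using insert unfolding * by auto
  next
    case False
    then show ?thesis using cyl_empty[of v "insert v W" c] by simp
  qed
qed

subsection \<open>The join of finitely many translates\<close>

text \<open>This is \<open>W \<cdot> \<alpha>\<close> for finite \<open>W\<close>, with blocks
  indexed by labellings. Labellings that never occur, in particular those leaving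
  \<open>\<alpha>\<close>, give the empty set, which is removed.\<close>

definition cells :: "'g set \<Rightarrow> 'a set set" where
  "cells W = range (cyl W) - {{}}"

lemma cells_partition:
  assumes "finite W"
  shows "countable_measurable_partition M (cells W)"
proof -
  have "cells W \<subseteq> cyl W ` (W \<rightarrow>\<^sub>E \<alpha>)"
  proof
    fix A assume "A \<in> cells W"
    then obtain c where c: "A = cyl W c" "A \<noteq> {}" by (auto simp: cells_def)
    then have "cyl W c = cyl W (restrict c W)" by (auto simp: cyl_def event_def)
    moreover have "restrict c W \<in> W \<rightarrow>\<^sub>E \<alpha>" using c cyl_empty by (auto intro!: restrict_PiE_iff[THEN iffD2])
    ultimately show "A \<in> cyl W ` (W \<rightarrow>\<^sub>E \<alpha>)" using c by blast
  qed
  then have "countable (cells W)"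
    by (rule countable_subset) (intro countable_image countable_labelings assms)
  moreover have "cells W \<subseteq> events" using cyl_events[OF assms] by (auto simp: cells_def)
  moreover have "partition_on (space M) (cells W)"
  proof (rule partition_onI)
    have "\<omega> \<in> cyl W (\<lambda>v. label v \<omega>)" if "\<omega> \<in> space M" for \<omega>
      using that by (simp add: cyl_def event_def)
    then show "\<Union> (cells W) = space M"
      using cyl_space unfolding cells_def by blast
    show "disjnt A B" if AB: "A \<in> cells W" "B \<in> cells W" "A \<noteq> B" for A B
    proof (rule ccontr)
      assume "\<not> disjnt A B"
      then obtain \<omega> c d where "A = cyl W c" "B = cyl W d" "\<omega> \<in> cyl W c" "\<omega> \<in> cyl W d"
        using AB by (auto simp: cells_def disjnt_def)
      then have "A = B" by (simp add: cyl_def event_def)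
      then show False using AB by simp
    qed
  qed (auto simp: cells_def)
  ultimately show ?thesis by (simp add: countable_measurable_partition_def)
qed

lemma cells_singleton:
  assumes "g \<in> carrier G"
  shows "cells {g} = (`) (\<phi> g) ` \<alpha>"
proof
  show "cells {g} \<subseteq> (`) (\<phi> g) ` \<alpha>"
    using cyl_singleton[OF assms] cyl_empty[of g "{g}"] by (force simp: cells_def)
  show "(`) (\<phi> g) ` \<alpha> \<subseteq> cells {g}"
  proof
    fix A assume "A \<in> (`) (\<phi> g) ` \<alpha>"
    then obtain a where a: "a \<in> \<alpha>" "A = \<phi> g ` a" by auto
    then have "a \<noteq> {}" using \<alpha> by (auto simp: countable_measurable_partition_def partition_on_def)
    then show "A \<in> cells {g}"
      using a cyl_singleton[OF assms, of "\<lambda>_. a"] by (auto simp: cells_def intro: rev_image_eqI)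
  qed
qed

lemma cells_insert:
  assumes "g \<notin> W"
  shows "cells (insert g W) = partition_join (cells {g}) (cells W)"
proof
  have Int: "cyl (insert g W) c = cyl {g} c \<inter> cyl W c" for c
    by (auto simp: cyl_def event_def)
  show "cells (insert g W) \<subseteq> partition_join (cells {g}) (cells W)"
  proof
    fix A assume "A \<in> cells (insert g W)"
    then obtain c where c: "A = cyl {g} c \<inter> cyl W c" "A \<noteq> {}" by (auto simp: cells_def Int)
    then have "(cyl {g} c, cyl W c) \<in> cells {g} \<times> cells W" by (auto simp: cells_def)
    then show "A \<in> partition_join (cells {g}) (cells W)"
      using c unfolding partition_join_def by (auto intro: rev_image_eqI)
  qed
  show "partition_join (cells {g}) (cells W) \<subseteq> cells (insert g W)"
  proof
    fix A assume "A \<in> partition_join (cells {g}) (cells W)"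
    then obtain c d where A: "A = cyl {g} c \<inter> cyl W d" "A \<noteq> {}"
      by (auto simp: cells_def partition_join_def)
    have "cyl {g} c \<inter> cyl W d = cyl (insert g W) (d(g := c g))"
      using assms by (auto simp: cyl_def event_def)
    then show "A \<in> cells (insert g W)" using A by (auto simp: cells_def)
  qed
qed

lemma entropy_cells_singleton:
  assumes "g \<in> carrier G"
  shows "shannon_entropy M (cells {g}) = shannon_entropy M \<alpha>"
proof -
  have "inj_on ((`) (\<phi> g)) \<alpha>"
    using inj_prop[OF assms] \<alpha>_space by (intro inj_onI) (meson inj_on_image_eq_iff)
  then have "shannon_entropy M (cells {g}) =
      (\<Sum>\<^sub>\<infinity>A\<in>\<alpha>. ennreal (- prob (\<phi> g ` A) * ln (prob (\<phi> g ` A))))"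
    unfolding shannon_entropy_def cells_singleton[OF assms]
    by (subst infsum_reindex) (auto simp: o_def)
  also have "\<dots> = shannon_entropy M \<alpha>"
    unfolding shannon_entropy_def
    by (intro infsum_cong) (simp add: prob_act_image[OF assms partition_events[OF \<alpha>]])
  finally show ?thesis .
qed

lemma entropy_cells_finite:
  assumes "finite W" "W \<subseteq> carrier G" "shannon_entropy M \<alpha> < \<infinity>"
  shows "shannon_entropy M (cells W) < \<infinity>"
  using assms(1,2)
proof (induction W rule: finite_induct)
  case empty
  have "cells {} = {space M}"
    using not_empty by (auto simp: cells_def cyl_def event_def)
  then show ?case by (simp add: shannon_entropy_def prob_space)
next
  case (insert g W)
  have "shannon_entropy M (cells (insert g W)) \<le>
      shannon_entropy M (cells {g}) + shannon_entropy M (cells W) + 1"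
    unfolding cells_insert[OF insert(2)] using insert(1)
    by (intro shannon_entropy_join_le cells_partition) auto
  also have "\<dots> < \<infinity>"
    using insert assms(3) entropy_cells_singleton by (auto simp: less_top[symmetric])
  finally show ?case .
qed

text \<open>As \<open>\<one>\<close> lies in \<open>W\<close>, every block of
  \<open>\<alpha>\<close> is a countable union of blocks of \<open>cells W\<close>, and translation
  commutes with unions.\<close>

lemma generating_cells:
  assumes "generating_partition G M \<phi> \<alpha>" "finite W" "W \<subseteq> carrier G" "\<one> \<in> W"
  shows "generating_partition G M \<phi> (cells W)"
proof -
  note part = cells_partition[OF assms(2)]
  let ?T = "translates_algebra M \<phi> (carrier G) (cells W)"
  have "\<phi> g ` a \<in> sets ?T" if g: "g \<in> carrier G" and a: "a \<in> \<alpha>" for g a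
  proof -
    have "a = cyl {\<one>} (\<lambda>_. a)"
      using a \<alpha>_space[OF a] by (simp add: cyl_singleton act_one subset_eq cong: image_cong_simp)
    also have "\<dots> = (\<Union>A\<in>{A \<in> cells W. A \<subseteq> cyl {\<one>} (\<lambda>_. a)}. A)" (is "?C = \<Union>(_ ` ?\<A>)")
    proof -
      have "\<exists>A\<in>cells W. A \<subseteq> ?C \<and> \<omega> \<in> A" if "\<omega> \<in> ?C" for \<omega>
      proof (intro bexI conjI)
        show "cyl W (\<lambda>v. label v \<omega>) \<subseteq> ?C" "\<omega> \<in> cyl W (\<lambda>v. label v \<omega>)"
          using that assms(4) by (auto simp: cyl_def event_def)
        then show "cyl W (\<lambda>v. label v \<omega>) \<in> cells W" by (auto simp: cells_def)
      qed
      then show ?thesis by blast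
    qed
    finally have "\<phi> g ` a = \<phi> g ` (\<Union>A\<in>?\<A>. A)" by (rule arg_cong)
    also have "\<dots> = (\<Union>A\<in>?\<A>. \<phi> g ` A)" by (rule image_UN)
    finally have eq: "\<phi> g ` a = (\<Union>A\<in>?\<A>. \<phi> g ` A)" .
    have cnt: "countable ?\<A>"
      using part by (intro countable_subset[of ?\<A> "cells W"])
        (auto simp: countable_measurable_partition_def)
    have "(\<lambda>A. \<phi> g ` A) ` ?\<A> \<subseteq> sets ?T"
    proof (rule image_subsetI)
      fix A assume "A \<in> ?\<A>"
      then show "\<phi> g ` A \<in> sets ?T"
        by (intro translates_basic[OF subset_refl part g]) simp
    qed
    then show ?thesis
      unfolding eq by (intro sets.countable_UN' cnt)
  qed
  then have "{\<phi> f ` A |f A. f \<in> carrier G \<and> A \<in> \<alpha>} \<subseteq> sets ?T" by auto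
  then have "sets (translates_algebra M \<phi> (carrier G) \<alpha>) \<subseteq> sets ?T"
    using sets.sigma_sets_subset[of _ ?T] sets_translates[OF _ \<alpha>, of "carrier G"] by simp
  then show ?thesis
    using assms(1) unfolding generating_partition_def by blast
qed

end

section \<open>The Markov property on finite windows\<close>

context free_basis
begin

definition ball :: "nat \<Rightarrow> 'g set" where
  "ball n = {g \<in> carrier G. length (word g) \<le> n}"

lemma ball_carrier: "ball n \<subseteq> carrier G"
  by (auto simp: ball_def)

lemma one_in_ball: "\<one> \<in> ball n"
  by (simp add: ball_def)

lemma finite_ball: "finite S \<Longrightarrow> finite (ball n)"
  unfolding ball_def by (rule finite_word_ball)

lemma exists_ball:
  assumes "finite W" "W \<subseteq> carrier G"
  shows "\<exists>n. W \<subseteq> ball n"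
proof -
  have "length (word g) \<le> Max ((\<lambda>g. length (word g)) ` W)" if "g \<in> W" for g
    using assms(1) that by simp
  then show ?thesis using assms(2) unfolding ball_def by blast
qed

end

text \<open>The Markov condition moved from \<open>\<one>\<close> to \<open>u\<close> by
  stationarity. The hypothesis \<open>past\<close> says that the window lies on the side of
  \<open>u\<close> of the edge from \<open>u\<close> to \<open>u \<otimes> s\<close>.\<close>

lemma (in partition_action) markov_leaf:
  assumes basis: "free_basis G S" and markov: "markov_process G M \<phi> S \<alpha>"
    and s: "s \<in> sym_gens G S" and u: "u \<in> N" and N: "finite N" "N \<subseteq> carrier G"
    and past: "\<And>n. n \<in> N \<Longrightarrow> inv u \<otimes> n \<in> RPast G S \<one> s"
  shows "prob (cyl (insert (u \<otimes> s) N) x) * prob (cyl {u} x) =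
         prob (cyl N x) * prob (cyl {u, u \<otimes> s} x)"
proof -
  interpret free_basis G S by (rule basis)
  let ?v = "u \<otimes> s" and ?F = "RPast G S \<one> s"
  have uG: "u \<in> carrier G" using u N by auto
  have sG: "s \<in> carrier G" using s sym_gens_closed by auto
  have vG: "?v \<in> carrier G" using uG sG by simp
  have F: "?F \<subseteq> carrier G" by (auto simp: RPast_def)
  show ?thesis
  proof (cases "x u \<in> \<alpha> \<and> x ?v \<in> \<alpha>")
    \<comment> \<open>A label outside \<open>\<alpha>\<close> at either end of the edge makes a
      cylinder on each side empty.\<close>
    case False
    then show ?thesis using u cyl_empty[of u _ x] cyl_empty[of ?v _ x] by auto
  next
    case True
    \<comment> \<open>Window and labelling seen from \<open>u\<close>, so that \<open>u\<close>
      becomes \<open>\<one>\<close> and the new leaf becomes \<open>s\<close>.\<close>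
    define N' where "N' = (\<lambda>h. inv u \<otimes> h) ` N"
    define x' where "x' = (\<lambda>k. x (u \<otimes> k))"
    have shift: "prob (cyl W x) = prob (cyl ((\<lambda>h. inv u \<otimes> h) ` W) x')"
      if "W \<subseteq> insert ?v N" for W
      unfolding x'_def using that N uG vG
      by (intro prob_cyl_shift[symmetric]) (auto intro: finite_subset)
    have one: "\<one> \<in> N'" using u uG by (auto simp: N'_def intro!: image_eqI[of _ _ u])
    have N'F: "N' \<subseteq> ?F" using past by (auto simp: N'_def)
    have vs: "inv u \<otimes> ?v = s" using uG sG by (simp add: m_assoc[symmetric])
    have x'1: "x' \<one> = x u" and x's: "x' s = x ?v" using uG by (simp_all add: x'_def)
    define A b where "A = x ?v" and "b = x u"
    have A: "A \<in> \<alpha>" and b: "b \<in> \<alpha>" using True by (simp_all add: A_def b_def)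
    have cs: "cyl {s} x' = \<phi> s ` A" using cyl_singleton[OF sG, of x'] A by (simp add: A_def x's)
    have c1: "cyl {\<one>} x' = b"
      using cyl_singleton[of \<one> x'] b \<alpha>_space[OF b]
      by (simp add: b_def x'1 act_one subset_eq cong: image_cong_simp)
    have D: "cyl N' x' \<in> sets (translates_algebra M \<phi> ?F \<alpha>)"
      using N by (intro cyl_in_translates F N'F) (simp add: N'_def)
    have "AE \<omega> in M. real_cond_exp M (translates_algebra M \<phi> ?F \<alpha>) (indicator (\<phi> s ` A)) \<omega> =
        real_cond_exp M (sigma (space M) \<alpha>) (indicator (\<phi> s ` A)) \<omega>"
      using markov A s unfolding markov_process_def by auto
    then have "prob (cyl N' x' \<inter> \<phi> s ` A \<inter> b) * prob b = prob (cyl N' x' \<inter> b) * prob (\<phi> s ` A \<inter> b)"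
      using cond_exp_partition_eq_iff[OF \<alpha> subalgebra_translates[OF F \<alpha>]
          partition_subset_translates[OF F \<alpha>] act_image_events[OF sG partition_events[OF \<alpha> A]]]
        one N'F b D by blast
    \<comment> \<open>Since \<open>\<one>\<close> belongs to \<open>N'\<close>, the cylinder over
      \<open>N'\<close> already lies in the conditioning block \<open>b\<close>.\<close>
    moreover have "cyl N' x' \<inter> \<phi> s ` A \<inter> b = cyl (insert s N') x'" "cyl N' x' \<inter> b = cyl N' x'"
        "\<phi> s ` A \<inter> b = cyl {\<one>, s} x'"
      unfolding cs[symmetric] c1[symmetric] using one by (auto simp: cyl_def event_def)
    ultimately have "prob (cyl (insert s N') x') * prob (cyl {\<one>} x') =
        prob (cyl N' x') * prob (cyl {\<one>, s} x')"
      using c1 by simp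
    then show ?thesis
      using shift[of "insert ?v N"] shift[of "{u}"] shift[OF subset_insertI] shift[of "{u, ?v}"] u uG
      by (simp add: vs N'_def)
  qed
qed

section \<open>Factorization along the tree and change of basis\<close>

locale free_markov_process = partition_action G M \<phi> \<alpha> + free_basis G S
  for G :: "('g, 'm) monoid_scheme" (structure) and M :: "'a measure" and \<phi> \<alpha> S +
  assumes markov: "markov_process G M \<phi> S \<alpha>"
begin

text \<open>
  A window closed under prefixes is built up from \<open>\<one>\<close> by adding leaves of the Cayley tree; when
  the leaf \<open>v\<close> is attached to \<open>u\<close>, the conditional probability of the label at \<open>v\<close> given
  the label at \<open>u\<close> is absorbed into the factor whose coordinates include both.
\<close>

lemma factors_prefix_closed:
  assumes cover: "A \<union> B = carrier G"
    and sep: "\<And>g s. g \<in> carrier G \<Longrightarrow> s \<in> sym_gens G S \<Longrightarrow>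
      {g, g \<otimes> s} \<subseteq> A \<or> {g, g \<otimes> s} \<subseteq> B"
    and "finite N" "N \<subseteq> carrier G" "\<one> \<in> N"
    and "\<And>g v l. g \<in> N \<Longrightarrow> word g = v @ [l] \<Longrightarrow> word_val G v \<in> N"
  shows "factors A B N"
  using assms(3-)
proof (induction "card N" arbitrary: N rule: less_induct)
  case less
  note N = less.prems
  \<comment> \<open>A longest element of \<open>N\<close> is a leaf: no other element extends its
    word, so deleting it keeps the window closed under prefixes.\<close>
  have "Max ((\<lambda>h. length (word h)) ` N) \<in> (\<lambda>h. length (word h)) ` N"
    using N(1,3) by (intro Max_in) auto
  then obtain g where g: "g \<in> N" and "length (word g) = Max ((\<lambda>h. length (word h)) ` N)"
    by auto
  then have max: "length (word h) \<le> length (word g)" if "h \<in> N" for h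
    using N(1) that by simp
  have gG: "g \<in> carrier G" using g N by auto
  show ?case
  proof (cases "word g = []")
    case True
    then have "word h = []" if "h \<in> N" for h using max[OF that] by simp
    then have "h = \<one>" if "h \<in> N" for h
      using that N(2) word_val_word[of h] by auto
    then have "N = {\<one>}" using N(3) by blast
    then show ?thesis using cover by (auto intro: factors_singleton)
  next
    case False
    then obtain v l where w: "word g = v @ [l]" by (metis append_butlast_last_id)
    have red: "v @ [l] \<in> reduced_words S" using word_reduced[OF gG] w by simp
    then have vred: "v \<in> reduced_words S" and l: "l \<in> S \<times> UNIV"
      by (simp_all add: append_reduced Cons_reduced)
    define u where "u = word_val G v"
    have wu: "word u = v" using vred by (simp add: u_def)
    have uN: "u \<in> N" using N(4)[OF g w] by (simp add: u_def)
    have ug: "u \<noteq> g" using wu w by auto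
    have g_eq: "g = u \<otimes> lval l"
      using word_val_word[OF gG] word_val_app[of v "[l]"] vred l unfolding w u_def
      by (auto dest: reduced_letters)
    have s: "lval l \<in> sym_gens G S" using l sym_gens_eq by auto
    let ?N = "N - {g}"
    have no_ext: "word n \<noteq> word g @ t" if "n \<in> ?N" for n t
    proof
      assume e: "word n = word g @ t"
      then have "t = []" using max[of n] that by simp
      then show False using e that gG N(2) word_val_word[of n] word_val_word[of g] by auto
    qed
    have IH: "factors A B ?N"
    proof (rule less.hyps)
      show "card ?N < card N" using g N(1) by (intro psubset_card_mono) auto
      show "finite ?N" "?N \<subseteq> carrier G" using N by auto
      show "\<one> \<in> ?N" using N(3) False by auto
      show "word_val G v' \<in> ?N" if n: "n \<in> ?N" and e: "word n = v' @ [l']" for n v' l'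
      proof -
        have nG: "n \<in> carrier G" using n N(2) by auto
        have "v' @ [l'] \<in> reduced_words S" using word_reduced[OF nG] e by simp
        then have "word (word_val G v') = v'" by (simp add: append_reduced)
        then have "word_val G v' \<noteq> g" using no_ext[OF n, of "[l']"] e by auto
        then show ?thesis using N(4)[of n] n e by auto
      qed
    qed
    have past: "inv u \<otimes> n \<in> RPast G S \<one> (lval l)" if n: "n \<in> ?N" for n
    proof -
      have nG: "n \<in> carrier G" and uG: "u \<in> carrier G" using n uN N(2) by auto
      have "\<nexists>t. word n = word u @ [l] @ t" using no_ext[OF n] w wu by auto
      then have "word (inv u \<otimes> n) = [] \<or> hd (word (inv u \<otimes> n)) \<noteq> l"
        using hd_word_inv_mult[OF uG nG] red wu by simp
      then show ?thesis using RPast_eq[OF l] uG nG by simp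
    qed
    have "factors A B (insert g ?N)"
    proof (rule factors_insert[OF IH])
      show "finite ?N" "u \<in> ?N" using N uN ug by auto
      show "{u, g} \<subseteq> A \<or> {u, g} \<subseteq> B"
        using sep[of u "lval l"] uN N(2) s g_eq by auto
      show "prob (cyl (insert g ?N) x) * prob (cyl {u} x) = prob (cyl ?N x) * prob (cyl {u, g} x)" for x
        unfolding g_eq using markov_leaf[OF free_basis_axioms markov s, of u ?N x] N uN ug past g_eq
        by auto
    qed
    then show ?thesis using g by (simp add: insert_absorb)
  qed
qed

lemma factors_ball:
  assumes "finite S" "A \<union> B = carrier G"
    and "\<And>g s. g \<in> carrier G \<Longrightarrow> s \<in> sym_gens G S \<Longrightarrow>
      {g, g \<otimes> s} \<subseteq> A \<or> {g, g \<otimes> s} \<subseteq> B"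
  shows "factors A B (ball n)"
proof (rule factors_prefix_closed[OF assms(2,3) finite_ball[OF assms(1)] ball_carrier one_in_ball])
  show "word_val G v \<in> ball n" if "g \<in> ball n" "word g = v @ [l]" for g v l
  proof -
    have "v @ [l] \<in> reduced_words S"
      using word_reduced[of g] that by (simp add: ball_def)
    then have "v \<in> reduced_words S" by (simp add: append_reduced)
    then show ?thesis using that by (auto simp: ball_def reduced_letters)
  qed
qed

text \<open>The sets \<open>V\<close>, \<open>W\<close> and \<open>A \<inter> B\<close> may have any
  shape, since they sit in a common ball, which is closed under prefixes. The law on the ball
  factors and the other coordinates are summed out.\<close>

lemma separation_cond_indep:
  assumes "finite S" "A \<union> B = carrier G" "finite (A \<inter> B)"
    and "\<And>g s. g \<in> carrier G \<Longrightarrow> s \<in> sym_gens G S \<Longrightarrow>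
      {g, g \<otimes> s} \<subseteq> A \<or> {g, g \<otimes> s} \<subseteq> B"
    and p: "finite V" "V \<subseteq> A" "depends_on V p" and q: "finite W" "W \<subseteq> B" "depends_on W q"
  shows "prob (event p \<inter> event q \<inter> cyl (A \<inter> B) c) * prob (cyl (A \<inter> B) c) =
         prob (event p \<inter> cyl (A \<inter> B) c) * prob (event q \<inter> cyl (A \<inter> B) c)"
proof -
  have "finite (V \<union> W \<union> A \<inter> B)" "V \<union> W \<union> A \<inter> B \<subseteq> carrier G" using assms by auto
  from exists_ball[OF this] obtain n where n: "V \<union> W \<union> A \<inter> B \<subseteq> ball n" by auto
  show ?thesis
  proof (rule factors_cond_indep[OF factors_ball[OF assms(1,2,4)] finite_ball[OF assms(1)]])
    show "ball n \<subseteq> A \<union> B" "A \<inter> B \<subseteq> ball n"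
      using n ball_carrier assms(2) by auto
    show "depends_on (A \<inter> ball n) p" "depends_on (B \<inter> ball n) q"
      using n p q by (auto elim!: depends_on_mono)
  qed
qed

text \<open>
  Neighbours in the \<open>S\<close>-Cayley tree have \<open>S'\<close>-distance at most \<open>R\<close>. Hence the \<open>S'\<close>-ball
  \<open>F\<close> of radius \<open>R\<close>, although possibly disconnected in the \<open>S\<close>-Cayley tree, separates there
  any two of the sets of points beyond \<open>F\<close> that lie in different branches of the \<open>S'\<close>-Cayley tree.
\<close>

lemma markov_cells_of_other_basis:
  assumes "free_basis G S'" and "finite S" and "finite S'"
  shows "\<exists>F. finite F \<and> F \<subseteq> carrier G \<and> markov_process G M \<phi> S' (cells F)"
proof -
  interpret T: free_basis G S' using assms(1) .
  have gen: "generating_partition G M \<phi> \<alpha>" using markov by (simp add: markov_process_def)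
  have "finite (sym_gens G S)" using assms(2) by (simp add: sym_gens_def)
  from T.exists_ball[OF this sym_gens_closed] obtain R where R: "sym_gens G S \<subseteq> T.ball R" by auto
  define F where "F = T.ball R"
  have F: "finite F" "F \<subseteq> carrier G" "\<one> \<in> F"
    using T.finite_ball[OF assms(3)] T.ball_carrier T.one_in_ball by (auto simp: F_def)
  note \<beta> = cells_partition[OF F(1)]
  have F_iff: "g \<in> F \<longleftrightarrow> length (T.word g) \<le> R" if "g \<in> carrier G" for g
    using that by (simp add: F_def T.ball_def)
  \<comment> \<open>Words outside \<open>F\<close> are longer than \<open>R\<close>, and an element
    of \<open>F\<close> cancels at most \<open>R\<close> letters.\<close>
  have hd_F: "hd (T.word (g \<otimes> k)) = hd (T.word g)" if "g \<in> carrier G" "g \<notin> F" "k \<in> F" for g k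
    using that F F_iff[of g] F_iff[of k] by (intro T.hd_word_mult) auto
  have inv_F: "inv k \<in> F" if "k \<in> F" for k
    using that F F_iff[of k] F_iff[of "inv k"] T.word_inv[of k] by auto
  have "prob (D \<inter> \<phi> s ` b' \<inter> b) * prob b = prob (D \<inter> b) * prob (\<phi> s ` b' \<inter> b)"
    if s: "s \<in> sym_gens G S'" and b: "b \<in> cells F" and b': "b' \<in> cells F"
      and D: "D \<in> sets (translates_algebra M \<phi> (RPast G S' \<one> s) (cells F))" for s b b' D
  proof -
    obtain m where m: "m \<in> S' \<times> UNIV" "s = lval m" using s T.sym_gens_eq by auto
    have sG: "s \<in> carrier G" using m by simp
    \<comment> \<open>\<open>B\<close> is the ball with the branch beginning with \<open>m\<close>,
      and \<open>A\<close> is the ball with all other branches. The unspecified \<open>hd []\<close>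
      is harmless because \<open>\<one>\<close> lies in \<open>F\<close>, hence on both
      sides.\<close>
    define A B where "A = {g \<in> carrier G. g \<in> F \<or> hd (T.word g) \<noteq> m}"
      and "B = {g \<in> carrier G. g \<in> F \<or> hd (T.word g) = m}"
    have AB: "A \<union> B = carrier G" "A \<inter> B = F" using F by (auto simp: A_def B_def)
    \<comment> \<open>If \<open>g\<close> is in \<open>F\<close>, it is on both sides and
      \<open>g \<otimes> t\<close> decides; otherwise both ends begin with the same letter by
      \<open>hd_F\<close>.\<close>
    have sep: "{g, g \<otimes> t} \<subseteq> A \<or> {g, g \<otimes> t} \<subseteq> B"
      if "g \<in> carrier G" "t \<in> sym_gens G S" for g t
    proof -
      have t: "t \<in> F" "t \<in> carrier G" using that R sym_gens_closed by (auto simp: F_def)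
      show ?thesis using hd_F[of g t] that t by (auto simp: A_def B_def)
    qed
    have past_F: "g \<otimes> f \<in> A" if g: "g \<in> RPast G S' \<one> s" and f: "f \<in> F" for g f
    proof -
      have gG: "g \<in> carrier G" and hg: "T.word g = [] \<or> hd (T.word g) \<noteq> m"
        using g T.RPast_eq[OF m(1)] m(2) by auto
      have fG: "f \<in> carrier G" using f F by auto
      show ?thesis
      proof (cases "g \<otimes> f \<in> F")
        case False
        \<comment> \<open>Outside \<open>F\<close> the translation is undone by
          \<open>inv f\<close>, which is again in the ball, so \<open>g\<close> and
          \<open>g \<otimes> f\<close> share their first letter. The same argument serves for
          \<open>s\<close> below.\<close>
        have "hd (T.word (g \<otimes> f \<otimes> inv f)) = hd (T.word (g \<otimes> f))"
          using hd_F[OF _ False inv_F[OF f]] gG fG by simp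
        then have h: "hd (T.word g) = hd (T.word (g \<otimes> f))"
          using gG fG by (simp add: m_assoc)
        have "g \<noteq> \<one>" using False f fG by auto
        then have "T.word g \<noteq> []" using T.word_val_word[OF gG] by auto
        then show ?thesis using hg h gG fG by (simp add: A_def)
      qed (use gG fG in \<open>simp add: A_def\<close>)
    qed
    have s_F: "s \<otimes> f \<in> B" if f: "f \<in> F" for f
    proof -
      have fG: "f \<in> carrier G" using f F by auto
      show ?thesis
      proof (cases "s \<otimes> f \<in> F")
        case False
        have "hd (T.word (s \<otimes> f \<otimes> inv f)) = hd (T.word (s \<otimes> f))"
          using hd_F[OF _ False inv_F[OF f]] sG fG by simp
        then have "hd (T.word (s \<otimes> f)) = m"
          using sG fG T.word_lval[OF m(1)] m(2) by (simp add: m_assoc)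
        then show ?thesis using sG fG by (simp add: B_def)
      qed (use sG fG in \<open>simp add: B_def\<close>)
    qed
    obtain c where c: "b = cyl F c" using b by (auto simp: cells_def)
    obtain c' where c': "b' = cyl F c'" using b' by (auto simp: cells_def)
    define q where "q = (\<lambda>x. \<forall>v\<in>(\<lambda>h. s \<otimes> h) ` F. x v = c' (inv s \<otimes> v))"
    have q: "\<phi> s ` b' = event q" "depends_on ((\<lambda>h. s \<otimes> h) ` F) q"
      unfolding c' q_def using act_image_cyl[OF sG F(2), of c', unfolded cyl_def[of "_ ` _"]]
      by (simp_all only: depends_on_cylinder)
    have q_events: "event q \<in> events" using event_events[OF _ q(2)] F by simp
    have b_events: "b \<in> events" using cyl_events[OF F(1)] c by simp
    have RG: "RPast G S' \<one> s \<subseteq> carrier G" by (auto simp: RPast_def)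
    \<comment> \<open>The past is infinite while the separation lemma handles finite windows, so
      \<open>D\<close> is reached from the \<pi>-system of events that depend on finitely many
      coordinates in \<open>A\<close>.\<close>
    define \<C> where "\<C> = {event p |p. \<exists>V. finite V \<and> V \<subseteq> A \<and> depends_on V p}"
    have \<C>I: "event p \<in> \<C>" if "finite V" "V \<subseteq> A" "depends_on V p" for p V
      using that unfolding \<C>_def by (intro CollectI exI[of _ p] exI[of _ V] conjI refl)
    have \<C>_events: "\<C> \<subseteq> events" using event_events by (auto simp: \<C>_def)
    then have \<C>_sigma: "sigma_sets (space M) \<C> \<subseteq> events" by (rule sets.sigma_sets_subset)
    have "{\<phi> g ` a |g a. g \<in> RPast G S' \<one> s \<and> a \<in> cells F} \<subseteq> \<C>"
    proof clarify
      fix g a assume g: "g \<in> RPast G S' \<one> s" and "a \<in> cells F"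
      then obtain d where d: "a = cyl F d" by (auto simp: cells_def)
      have gG: "g \<in> carrier G" using g RG by auto
      have eq: "\<phi> g ` a = event (\<lambda>x. \<forall>v\<in>(\<lambda>h. g \<otimes> h) ` F. x v = d (inv g \<otimes> v))"
        unfolding d using act_image_cyl[OF gG F(2), of d, unfolded cyl_def[of "_ ` _"]] .
      have "finite ((\<lambda>h. g \<otimes> h) ` F)" "(\<lambda>h. g \<otimes> h) ` F \<subseteq> A"
        using F(1) past_F[OF g] by auto
      then show "\<phi> g ` a \<in> \<C>" unfolding eq by (rule \<C>I[OF _ _ depends_on_cylinder])
    qed
    then have "sets (translates_algebra M \<phi> (RPast G S' \<one> s) (cells F)) \<subseteq> sigma_sets (space M) \<C>"
      unfolding sets_translates[OF RG \<beta>] by (rule sigma_sets_mono')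
    then have D': "D \<in> sigma_sets (space M) \<C>" using D by auto
    have stable: "Int_stable \<C>"
    proof (rule Int_stableI)
      fix D1 D2 assume "D1 \<in> \<C>" "D2 \<in> \<C>"
      then obtain p V p' V' where p: "D1 = event p" "finite V" "V \<subseteq> A" "depends_on V p"
        and p': "D2 = event p'" "finite V'" "V' \<subseteq> A" "depends_on V' p'"
        by (auto simp: \<C>_def)
      show "D1 \<inter> D2 \<in> \<C>"
        unfolding p(1) p'(1) event_Int
        using p p' by (intro \<C>I[OF _ _ depends_on_conj[OF p(4) p'(4)]]) auto
    qed
    have "\<C> \<subseteq> Pow (space M)" by (auto simp: \<C>_def event_def)
    \<comment> \<open>As functions of \<open>D\<close>, both sides are finite measures with the same
      total mass, so agreement on the \<pi>-system passes to the generated \<sigma>-algebra.\<close>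
    from stable this D' have "prob (D \<inter> event q \<inter> b) * prob b = prob (D \<inter> b) * prob (event q \<inter> b)"
    proof (induction rule: sigma_sets_induct_disjoint)
      case (basic E)
      then obtain p V where p: "E = event p" "finite V" "V \<subseteq> A" "depends_on V p"
        by (auto simp: \<C>_def)
      show ?case
        using separation_cond_indep[OF assms(2) AB(1) _ sep p(2-4) _ _ q(2), of c] F s_F
        by (auto simp: p(1) c AB(2))
    next
      case empty
      show ?case by simp
    next
      case (compl E)
      have E: "E \<in> events" using compl(1) \<C>_sigma by auto
      have diff: "prob ((space M - E) \<inter> Z) = prob Z - prob (E \<inter> Z)" if "Z \<in> events" for Z
      proof -
        have "(space M - E) \<inter> Z = Z - E \<inter> Z" using sets.sets_into_space[OF that] by auto
        then show ?thesis using finite_measure_Diff[of Z "E \<inter> Z"] that E by auto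
      qed
      show ?case
        using diff[of "event q \<inter> b"] diff[of b] q_events b_events compl(2)
        by (simp add: Int_assoc left_diff_distrib right_diff_distrib mult.commute)
    next
      case (union E)
      have E: "range E \<subseteq> events" using union(2) \<C>_sigma by auto
      have UN: "(\<lambda>i. prob (E i \<inter> Z)) sums prob ((\<Union>i. E i) \<inter> Z)" if "Z \<in> events" for Z
      proof -
        have "(\<Union>i. E i) \<inter> Z = (\<Union>i. E i \<inter> Z)" by auto
        then show ?thesis
          using finite_measure_UNION[of "\<lambda>i. E i \<inter> Z"] E that union(1)
          by (auto simp: disjoint_family_on_def)
      qed
      have "(\<lambda>i. prob (E i \<inter> b) * prob (event q \<inter> b)) sums
          (prob ((\<Union>i. E i) \<inter> event q \<inter> b) * prob b)"
        using sums_mult2[OF UN[of "event q \<inter> b"], of "prob b"] q_events b_events union(3)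
        by (simp add: Int_assoc)
      moreover have "(\<lambda>i. prob (E i \<inter> b) * prob (event q \<inter> b)) sums
          (prob ((\<Union>i. E i) \<inter> b) * prob (event q \<inter> b))"
        using sums_mult2[OF UN[OF b_events]] .
      ultimately show ?case by (rule sums_unique2)
    qed
    then show ?thesis by (simp add: q(1))
  qed
  \<comment> \<open>The past contains \<open>\<one>\<close>, so its \<sigma>-algebra refines that of
    \<open>cells F\<close>, as the criterion for conditional expectations demands.\<close>
  moreover have "RPast G S' \<one> s \<subseteq> carrier G" "\<one> \<in> RPast G S' \<one> s" "s \<in> carrier G"
    if s: "s \<in> sym_gens G S'" for s
  proof -
    obtain m where "m \<in> S' \<times> UNIV" "s = lval m" using s T.sym_gens_eq by auto
    then show "RPast G S' \<one> s \<subseteq> carrier G" "\<one> \<in> RPast G S' \<one> s" "s \<in> carrier G"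
      using T.RPast_eq[of m] by auto
  qed
  ultimately have "markov_process G M \<phi> S' (cells F)"
    unfolding markov_process_def
    using \<beta> generating_cells[OF gen F]
      cond_exp_partition_eq_iff[OF \<beta> subalgebra_translates[OF _ \<beta>] partition_subset_translates[OF _ \<beta>]
        act_image_events[OF _ partition_events[OF \<beta>]]]
    by simp
  then show ?thesis using F by blast
qed

end

theorem corollary5p12:
  fixes G :: "('g, 'm) monoid_scheme"
    and M :: "'a measure"
    and \<phi> :: "'g \<Rightarrow> 'a \<Rightarrow> 'a"
    and S\<^sub>1 S\<^sub>2 :: "'g set"
    and \<alpha>\<^sub>1 :: "'a set set"
  assumes "free_group G" and "finitely_generated_group G"
    and "standard_prob_space M"
    and "pmp_action G M \<phi>"
    and "free_generating_set G S\<^sub>1" and "free_generating_set G S\<^sub>2"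
    and "markov_process G M \<phi> S\<^sub>1 \<alpha>\<^sub>1"
    and "shannon_entropy M \<alpha>\<^sub>1 < \<infinity>"
  shows "\<exists>\<alpha>\<^sub>2. countable_measurable_partition M \<alpha>\<^sub>2 \<and> shannon_entropy M \<alpha>\<^sub>2 < \<infinity> \<and>
           markov_process G M \<phi> S\<^sub>2 \<alpha>\<^sub>2"
proof -
  have "group G" using assms(1) by (simp add: free_group_def)
  have part: "countable_measurable_partition M \<alpha>\<^sub>1"
    using assms(7) by (auto simp: markov_process_def)
  have basis: "free_basis G S" if "free_generating_set G S" for S
    using \<open>group G\<close> that by (simp add: free_basis_def free_basis_axioms_def)
  have "partition_action G M \<phi> \<alpha>\<^sub>1"
    using assms(3,4) part
    by (auto simp: partition_action_def partition_action_axioms_def standard_prob_space_def pmp_action_def)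
  then interpret free_markov_process G M \<phi> \<alpha>\<^sub>1 S\<^sub>1
    using basis[OF assms(5)] assms(7)
    by (simp add: free_markov_process_def free_markov_process_axioms_def)
  \<comment> \<open>Finite generation enters here: both bases, and hence their balls, are
    finite.\<close>
  have "finite S\<^sub>1" "finite S\<^sub>2"
    using finite_basis free_basis.finite_basis[OF basis[OF assms(6)]] assms(2) by auto
  then obtain F where "finite F" "F \<subseteq> carrier G" "markov_process G M \<phi> S\<^sub>2 (cells F)"
    using markov_cells_of_other_basis[OF basis[OF assms(6)]] by auto
  then show ?thesis
    using cells_partition entropy_cells_finite[OF _ _ assms(8)] by blast
qed

end
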